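(* Let $m>0$. Let $P(\cdot,\cdot)\ge 0$ and $V(\cdot,\cdot)$ be relative functionals, $\mathcal{E}(E)=P(E)+V(E)$, and let $\mathcal{F}$ denote either of $P$ and $V$ (a property stated for $\mathcal{F}$ is assumed for both). Assume the following. (Relative isoperimetric inequality) There exist $r_0>0$ and an increasing $f_1:\mathbb{R}_+\to\mathbb{R}_+$ with $f_1(0)=0$, $t\mapsto f_1(t)/t$ nonincreasing and $\lim_{t\to 0}f_1(t)/t=\infty$, such that for all $r\le r_0$, $x\in\mathbb{R}^d$, $E\subset\mathbb{R}^d$: $\min\big(f_1(|E\cap B_r(x)|),f_1(|B_r(x)\setminus E|)\big)\le P(E,B_r(x))$. (Periodicity) There exists $0<r_1\le 2r_0/\sqrt d$ such that $\mathcal{F}(E+r_1e_k,U+r_1e_k)=\mathcal{F}(E,U)$ for all $1\le k\le d$ and $E,U\subset\mathbb{R}^d$. (Perimeter set operations) For $E\subset\mathbb{R}^d$: if $U\subset U'$ are open, then $P(E,U)\le P(E,U')$; if $(U_i)_{i=1}^I$ are disjoint open sets, then $\sum_{i=1}^I P(E,U_i)\le P(E,\cup_{i=1}^I U_i)$. (Bounded perimeter) If $(E_n)_n$ satisfies $\sup_n\mathcal{E}(E_n)<\infty$ and $\sup_n|E_n|<\infty$, then $\sup_n P(E_n)<\infty$. (Compactness) If $(E_n)_n$ satisfies $\sup_n P(E_n,U)<\infty$, then up to extraction there exists $E\subset\mathbb{R}^d$ such that $E_n\cap U\to E$ in $L^1_{\mathrm{loc}}$ as $n\to\infty$. (Lower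 semicontinuity) Given $E\subset\mathbb{R}^d$ and a bounded open set $U$, if $E_n\to E$ in $L^1_{\mathrm{loc}}$ with $\sup_n|E_n|<\infty$, then $\mathcal{F}(E,U)\le\liminf_n\mathcal{F}(E_n,U)$. (Beppo-Levi) If $(U_n)_{n\ge0}$ is a nondecreasing sequence of open sets exhausting $\mathbb{R}^d$, then for any $E\subset\mathbb{R}^d$, $\mathcal{F}(E,U_n)\to\mathcal{F}(E)$ as $n\to\infty$. (Weak superadditivity) For any $M>0$ there exist $\eta_1,\eta_2:\mathbb{R}_+\to\mathbb{R}_+$ with $\eta_1$ continuous, $\eta_1(0)=0$ and $\eta_2(r)\to0$ as $r\to\infty$, such that for any $E\subset\mathbb{R}^d$ with $|E|\le M$ and any finite family of balls $(B^i)_{i=1}^I$ of radius $R>0$ with $\min_{i\ne j}\mathrm{dist}(B^i,B^j)\ge 5R$, $$\sum_{i=1}^I V(E,B^i)\le V(E)+\eta_1\big(|E\setminus\cup_{i=1}^I B^i|\big)+\eta_2(R).$$ Assume moreover that $e(m)=e_{\mathrm{gen}}(m)$, where $$e(m)=\inf\{\mathcal{E}(E):|E|=m\},\qquad e_{\mathrm{gen}}(m)=\inf\Big\{\sum_{i\ge1}\mathcal{E}(E^i):\sum_{i\ge1}|E^i|=m\Big\}.$$ Then the problem defining $e_{\mathrm{gen}}(m)$ admits a solution: there is a sequence $(E^i)_{i\ge1}$ of subsets of $\mathbb{R}^d$ with $\sum_i|E^i|=m$ and $\sum_i\mathcal{E}(E^i)=e_{\mathrm{gen}}(m)$.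
   Context: $d\ge2$. All sets are Lebesgue measurable subsets of $\mathbb{R}^d$; $|E|$ is Lebesgue measure; $B_r(x)$ is the ball of radius $r$ centered at $x$; $(e_k)_{k=1}^d$ is the canonical basis. Convergence of sets in $L^1_{\mathrm{loc}}$ means $L^1_{\mathrm{loc}}(\mathbb{R}^d)$ convergence of characteristic functions. The functionals $E\mapsto P(E,U)$ (nonnegative, possibly $+\infty$) and $E\mapsto V(E,U)$ (not necessarily nonnegative) are defined relatively to a measurable set $U\subset\mathbb{R}^d$, with the convention $P(E)=P(E,\mathbb{R}^d)$, $V(E)=V(E,\mathbb{R}^d)$. *)

theory Defs
  imports "HOL-Analysis.Analysis"
begin

text \<open>
  A relative functional assigns a value to a measurable set \<open>E\<close> and a measurable window \<open>U\<close>.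
  It is a total function here; every hypothesis below constrains it on Lebesgue measurable
  arguments only.
\<close>

type_synonym 'd rel_functional = "(real^'d) set \<Rightarrow> (real^'d) set \<Rightarrow> ereal"

definition L1loc_tendsto :: "(nat \<Rightarrow> (real^'d) set) \<Rightarrow> (real^'d) set \<Rightarrow> bool" where
  "L1loc_tendsto En E \<longleftrightarrow>
     (\<forall>K. compact K \<longrightarrow>
       (\<lambda>n. LINT x:K|lebesgue. \<bar>indicat_real (En n) x - indicat_real E x\<bar>) \<longlonglongrightarrow> 0)"

definition energy :: "'d::finite rel_functional \<Rightarrow> 'd rel_functional \<Rightarrow> (real^'d) set \<Rightarrow> ereal" where
  "energy P V E = P E UNIV + V E UNIV"

definition min_energy :: "'d::finite rel_functional \<Rightarrow> 'd rel_functional \<Rightarrow> real \<Rightarrow> ereal" where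
  "min_energy P V m =
     Inf {energy P V E | E. E \<in> sets lebesgue \<and> emeasure lebesgue E = ennreal m}"

definition gen_admissible :: "real \<Rightarrow> (nat \<Rightarrow> (real^'d::finite) set) \<Rightarrow> bool" where
  "gen_admissible m Es \<longleftrightarrow>
     (\<forall>i. Es i \<in> sets lebesgue) \<and> (\<Sum>i. emeasure lebesgue (Es i)) = ennreal m"

text \<open>
  The energies of the components need not be nonnegative, so the series is required to converge
  in the extended reals; \<open>suminf\<close> would give an unspecified value to a divergent one.
\<close>

definition gen_min_energy :: "'d::finite rel_functional \<Rightarrow> 'd rel_functional \<Rightarrow> real \<Rightarrow> ereal" where
  "gen_min_energy P V m =
     Inf {s. \<exists>Es. gen_admissible m Es \<and> (\<lambda>i. energy P V (Es i)) sums s}"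

definition relative_isoperimetric ::
    "real \<Rightarrow> (real \<Rightarrow> real) \<Rightarrow> 'd::finite rel_functional \<Rightarrow> bool" where
  "relative_isoperimetric r0 f1 P \<longleftrightarrow>
     0 < r0 \<and> f1 \<in> {0..} \<rightarrow> {0..} \<and> mono_on {0..} f1 \<and> f1 0 = 0 \<and>
     antimono_on {0<..} (\<lambda>t. f1 t / t) \<and>
     filterlim (\<lambda>t. f1 t / t) at_top (at_right 0) \<and>
     (\<forall>r x. \<forall>E\<in>sets lebesgue. 0 < r \<and> r \<le> r0 \<longrightarrow>
        ereal (min (f1 (measure lebesgue (E \<inter> ball x r))) (f1 (measure lebesgue (ball x r - E))))
          \<le> P E (ball x r))"

definition lattice_periodic :: "real \<Rightarrow> 'd::finite rel_functional \<Rightarrow> bool" where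
  "lattice_periodic r1 F \<longleftrightarrow>
     (\<forall>k. \<forall>E\<in>sets lebesgue. \<forall>U\<in>sets lebesgue.
        F ((\<lambda>x. x + r1 *\<^sub>R axis k 1) ` E) ((\<lambda>x. x + r1 *\<^sub>R axis k 1) ` U) = F E U)"

definition perimeter_set_operations :: "'d::finite rel_functional \<Rightarrow> bool" where
  "perimeter_set_operations P \<longleftrightarrow>
     (\<forall>E\<in>sets lebesgue.
        (\<forall>U U'. open U \<and> open U' \<and> U \<subseteq> U' \<longrightarrow> P E U \<le> P E U') \<and>
        (\<forall>I::nat. \<forall>U. (\<forall>i\<in>{1..I}. open (U i)) \<and> disjoint_family_on U {1..I} \<longrightarrow>
           (\<Sum>i=1..I. P E (U i)) \<le> P E (\<Union>i\<in>{1..I}. U i)))"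

definition bounded_perimeter :: "'d::finite rel_functional \<Rightarrow> 'd rel_functional \<Rightarrow> bool" where
  "bounded_perimeter P V \<longleftrightarrow>
     (\<forall>En. (\<forall>n::nat. En n \<in> sets lebesgue) \<and>
        (SUP n. energy P V (En n)) < \<infinity> \<and> (SUP n. emeasure lebesgue (En n)) < \<infinity> \<longrightarrow>
        (SUP n. P (En n) UNIV) < \<infinity>)"

definition perimeter_compactness :: "'d::finite rel_functional \<Rightarrow> bool" where
  "perimeter_compactness P \<longleftrightarrow>
     (\<forall>U\<in>sets lebesgue. \<forall>En. (\<forall>n::nat. En n \<in> sets lebesgue) \<and> (SUP n. P (En n) U) < \<infinity> \<longrightarrow>
        (\<exists>\<phi>. \<exists>E\<in>sets lebesgue. strict_mono \<phi> \<and> L1loc_tendsto (\<lambda>n. En (\<phi> n) \<inter> U) E))"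

definition lower_semicontinuity :: "'d::finite rel_functional \<Rightarrow> bool" where
  "lower_semicontinuity F \<longleftrightarrow>
     (\<forall>E\<in>sets lebesgue. \<forall>U En. open U \<and> bounded U \<and> (\<forall>n::nat. En n \<in> sets lebesgue) \<and>
        L1loc_tendsto En E \<and> (SUP n. emeasure lebesgue (En n)) < \<infinity> \<longrightarrow>
        F E U \<le> liminf (\<lambda>n. F (En n) U))"

definition beppo_levi :: "'d::finite rel_functional \<Rightarrow> bool" where
  "beppo_levi F \<longleftrightarrow>
     (\<forall>U. (\<forall>n::nat. open (U n)) \<and> incseq U \<and> (\<Union>n. U n) = UNIV \<longrightarrow>
        (\<forall>E\<in>sets lebesgue. (\<lambda>n. F E (U n)) \<longlonglongrightarrow> F E UNIV))"

definition weak_superadditivity :: "'d::finite rel_functional \<Rightarrow> bool" where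
  "weak_superadditivity V \<longleftrightarrow>
     (\<forall>M>0. \<exists>\<eta>1 \<eta>2 :: real \<Rightarrow> real.
        \<eta>1 \<in> {0..} \<rightarrow> {0..} \<and> \<eta>2 \<in> {0..} \<rightarrow> {0..} \<and>
        continuous_on {0..} \<eta>1 \<and> \<eta>1 0 = 0 \<and> (\<eta>2 \<longlongrightarrow> 0) at_top \<and>
        (\<forall>E\<in>sets lebesgue. \<forall>R>0. \<forall>I\<ge>1::nat. \<forall>c.
           emeasure lebesgue E \<le> ennreal M \<and>
           (\<forall>i\<in>{1..I}. \<forall>j\<in>{1..I}. i \<noteq> j \<longrightarrow> setdist (ball (c i) R) (ball (c j) R) \<ge> 5 * R) \<longrightarrow>
           (\<Sum>i=1..I. V E (ball (c i) R))
             \<le> V E UNIV + ereal (\<eta>1 (measure lebesgue (E - (\<Union>i\<in>{1..I}. ball (c i) R))))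
                 + ereal (\<eta>2 R)))"

end

theory Submission
  imports Defs "HOL-Library.Diagonal_Subsequence"
begin

text \<open>
  Take a minimizing sequence \<open>E\<^sub>n\<close> for the classical problem.  On the balls circumscribed about the
  cells of the cubic lattice the isoperimetric inequality bounds the mass of \<open>E\<^sub>n\<close> in a ball of
  small mass \<open>t\<close> by \<open>(t / f1 t)\<close> times the perimeter in that ball; as \<open>t / f1 t\<close> tends to \<open>0\<close> and the
  balls overlap boundedly often, all but \<open>\<epsilon>\<close> of the mass lies in boundedly many balls, uniformly
  in \<open>n\<close>.  Along a subsequence the sets recentered at each of these lattice points converge locally
  and two centers either stay at bounded distance or drift apart.  One limit for each class of
  centers at bounded distance gives components of total mass \<open>m\<close>.  Superadditivity on balls
  around diverging centers and lower semicontinuity give, for any finite set of components with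
  total mass \<open>\<mu>\<close>, an energy of at most \<open>e m + \<eta>1 (m - \<mu>)\<close>.  Applied to the components of positive
  energy, this bound makes the energy series converge; applied to initial segments it bounds the
  sum by \<open>e m\<close>, which equals the generalized infimum.
\<close>

section \<open>Translations and local convergence\<close>

text \<open>For \<open>a = r1\<close> this is the group generated by the translations under which
  the functionals are invariant. All centers are taken in it, so that recentering changes no
  energy.\<close>

definition cubic_lattice :: "real \<Rightarrow> (real^'d::finite) set" where
  "cubic_lattice a = {v. \<forall>k. \<exists>z::int. v $ k = a * of_int z}"

lemma zero_in_cubic_lattice: "0 \<in> cubic_lattice a"
  by (auto simp: cubic_lattice_def intro: exI[of _ 0])

lemma cubic_lattice_uminus: "v \<in> cubic_lattice a \<Longrightarrow> -v \<in> cubic_lattice a"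
  unfolding cubic_lattice_def
  by clarsimp (metis mult_minus_right of_int_minus)

lemma shift_in_lebesgue:
  fixes E :: "(real^'d::finite) set"
  assumes "E \<in> sets lebesgue"
  shows "(\<lambda>x. x + v) ` E \<in> sets lebesgue"
  using lebesgue_sets_translation[OF assms, of v] by (simp add: add.commute)

text \<open>The translations that preserve \<open>F\<close> form a group \<open>T\<close> under
  addition. It contains the generators \<open>r1 *\<^sub>R axis k 1\<close>, hence all their integer
  combinations.\<close>

lemma lattice_periodic_shift:
  fixes F :: "'d::finite rel_functional"
  assumes per: "lattice_periodic r1 F" and v: "v \<in> cubic_lattice r1"
    and E: "E \<in> sets lebesgue" and U: "U \<in> sets lebesgue"
  shows "F ((\<lambda>x. x + v) ` E) ((\<lambda>x. x + v) ` U) = F E U"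
proof -
  define T where "T = {v. \<forall>E\<in>sets lebesgue. \<forall>U\<in>sets lebesgue.
        F ((\<lambda>x. x + v) ` E) ((\<lambda>x. x + v) ` U) = F E U}"
  have add: "u + w \<in> T" if u: "u \<in> T" and w: "w \<in> T" for u w
    unfolding T_def
  proof (intro CollectI ballI)
    fix E U :: "(real^'d) set" assume E: "E \<in> sets lebesgue" and U: "U \<in> sets lebesgue"
    have comp: "(\<lambda>x. x + (u + w)) ` A = (\<lambda>x. x + w) ` (\<lambda>x. x + u) ` A" for A :: "(real^'d) set"
      by (simp add: image_image add.assoc)
    show "F ((\<lambda>x. x + (u + w)) ` E) ((\<lambda>x. x + (u + w)) ` U) = F E U"
      using u w E U by (simp add: comp T_def shift_in_lebesgue)
  qed
  have neg: "- u \<in> T" if u: "u \<in> T" for u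
    unfolding T_def
  proof (intro CollectI ballI)
    fix E U :: "(real^'d) set" assume E: "E \<in> sets lebesgue" and U: "U \<in> sets lebesgue"
    have inv: "(\<lambda>x. x + u) ` (\<lambda>x. x + - u) ` A = A" for A :: "(real^'d) set"
      by (simp add: image_image)
    have "F ((\<lambda>x. x + u) ` (\<lambda>x. x + - u) ` E) ((\<lambda>x. x + u) ` (\<lambda>x. x + - u) ` U)
        = F ((\<lambda>x. x + - u) ` E) ((\<lambda>x. x + - u) ` U)"
      using u shift_in_lebesgue[OF E] shift_in_lebesgue[OF U] unfolding T_def by blast
    then show "F ((\<lambda>x. x + - u) ` E) ((\<lambda>x. x + - u) ` U) = F E U"
      unfolding inv by simp
  qed
  have zero: "0 \<in> T" by (simp add: T_def)
  have nat: "of_nat n *\<^sub>R u \<in> T" if "u \<in> T" for u n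
    by (induction n) (simp_all add: zero add that scaleR_left_distrib)
  have int: "of_int z *\<^sub>R u \<in> T" if "u \<in> T" for u z
  proof (cases z)
    case (nonneg n) then show ?thesis using nat[OF that] by simp
  next
    case (neg n)
    have "- (of_nat (Suc n) *\<^sub>R u) \<in> T" using nat[OF that] \<open>\<And>u. u \<in> T \<Longrightarrow> - u \<in> T\<close> by blast
    moreover have "of_int z *\<^sub>R u = - (of_nat (Suc n) *\<^sub>R u)"
      unfolding neg by (simp add: algebra_simps)
    ultimately show ?thesis by simp
  qed
  have gen: "r1 *\<^sub>R axis k 1 \<in> T" for k
    using per by (auto simp: T_def lattice_periodic_def)
  obtain z :: "'d \<Rightarrow> int" where z: "\<And>k. v $ k = r1 * of_int (z k)"
    using v unfolding cubic_lattice_def by (auto) metis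
  have "(\<Sum>k\<in>S. of_int (z k) *\<^sub>R (r1 *\<^sub>R axis k 1)) \<in> T" if "finite S" for S
    using that
    by (induction S) (auto simp del: scaleR_scaleR intro!: zero add int gen)
  moreover have "(\<Sum>k\<in>UNIV. of_int (z k) *\<^sub>R (r1 *\<^sub>R axis k 1)) = v"
    by (vector axis_def z) (simp add: if_distrib sum.delta cong: if_cong)
  ultimately have "v \<in> T" by (metis finite)
  then show ?thesis using E U by (simp add: T_def)
qed

lemma lattice_periodic_recenter:
  fixes F :: "'d::finite rel_functional"
  assumes "lattice_periodic r1 F" "v \<in> cubic_lattice r1" "E \<in> sets lebesgue"
  shows "F ((\<lambda>x. x - v) ` E) (ball 0 R) = F E (ball v R)"
    and "F ((\<lambda>x. x - v) ` E) UNIV = F E UNIV"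
proof -
  have "(\<lambda>x. x + - v) ` ball v R = ball 0 R"
    using ball_translation[of "-v" v R] by simp
  then show "F ((\<lambda>x. x - v) ` E) (ball 0 R) = F E (ball v R)"
    using lattice_periodic_shift[OF assms(1) cubic_lattice_uminus[OF assms(2)] assms(3), of "ball v R"]
    by simp
  have "(\<lambda>x. x + - v) ` UNIV = UNIV"
    by (metis surj_def diff_add_cancel add_uminus_conv_diff)
  then show "F ((\<lambda>x. x - v) ` E) UNIV = F E UNIV"
    using lattice_periodic_shift[OF assms(1) cubic_lattice_uminus[OF assms(2)] assms(3), of UNIV]
    by simp
qed

lemma measure_recenter:
  fixes E :: "(real^'d::finite) set"
  shows "measure lebesgue ((\<lambda>x. x - v) ` E \<inter> ball 0 R) = measure lebesgue (E \<inter> ball v R)"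
proof -
  have "(\<lambda>x. x - v) ` E \<inter> ball 0 R = (\<lambda>x. x - v) ` (E \<inter> ball v R)"
    by (auto simp: dist_norm norm_minus_commute)
  then show ?thesis by (simp add: measure_translation_subtract)
qed

lemma L1loc_tendsto_subseq:
  "L1loc_tendsto En E \<Longrightarrow> strict_mono r \<Longrightarrow> L1loc_tendsto (\<lambda>n. En (r n)) E"
  unfolding L1loc_tendsto_def
  using LIMSEQ_subseq_LIMSEQ[where f=r] by (fastforce simp: o_def)

lemma L1loc_tendsto_offset:
  "L1loc_tendsto (\<lambda>n. En (n + k)) E \<Longrightarrow> L1loc_tendsto En E"
  unfolding L1loc_tendsto_def by (intro allI impI, rule LIMSEQ_offset[where k = k]) simp

text \<open>The two measures differ by at most the integral of the difference of the indicators over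
  \<open>cball 0 R\<close>. The closed ball appears because \<open>L1loc_tendsto\<close> tests
  compact sets only.\<close>

lemma L1loc_tendsto_measure:
  fixes E :: "(real^'d::finite) set"
  assumes lim: "L1loc_tendsto En E" and En: "\<And>n. En n \<in> sets lebesgue" and E: "E \<in> sets lebesgue"
  shows "(\<lambda>n. measure lebesgue (En n \<inter> ball 0 R)) \<longlonglongrightarrow> measure lebesgue (E \<inter> ball 0 R)"
proof -
  let ?K = "cball 0 R :: (real^'d) set"
  let ?d = "\<lambda>n. LINT x:?K|lebesgue. \<bar>indicat_real (En n) x - indicat_real E x\<bar>"
  have fin: "A \<inter> ball 0 R \<in> lmeasurable" if "A \<in> sets lebesgue" for A :: "(real^'d) set"
    using fmeasurable_Int_fmeasurable[OF lmeasurable_ball that] by (simp add: Int_commute)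
  have bound: "norm (measure lebesgue (En n \<inter> ball 0 R) - measure lebesgue (E \<inter> ball 0 R)) \<le> ?d n" for n
  proof -
    have i1: "integrable lebesgue (indicat_real (En n \<inter> ball 0 R))"
      and i2: "integrable lebesgue (indicat_real (E \<inter> ball 0 R))"
      using fin[OF En[of n]] fin[OF E]  by (auto simp: lmeasurable_iff_integrable)
    let ?g = "\<lambda>x. indicat_real ?K x * \<bar>indicat_real (En n) x - indicat_real E x\<bar>"
    have meas: "?g \<in> borel_measurable lebesgue"
      using En[of n] E
      by (intro borel_measurable_times borel_measurable_abs borel_measurable_diff borel_measurable_indicator)
        auto
    have int: "integrable lebesgue (indicat_real ?K)"
      using lmeasurable_cball lmeasurable_iff_integrable by blast
    have bnd: "AE x in lebesgue. norm (?g x) \<le> norm (indicat_real ?K x)"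
      by (simp add: indicator_def)
    have i3: "integrable lebesgue ?g"
      by (rule Bochner_Integration.integrable_bound[OF int meas bnd])
    have "measure lebesgue (En n \<inter> ball 0 R) - measure lebesgue (E \<inter> ball 0 R)
        = (LINT x|lebesgue. indicat_real (En n \<inter> ball 0 R) x - indicat_real (E \<inter> ball 0 R) x)"
      using i1 i2 by simp
    also have "norm \<dots> \<le> (LINT x|lebesgue. norm (indicat_real (En n \<inter> ball 0 R) x - indicat_real (E \<inter> ball 0 R) x))"
      by (rule integral_norm_bound)
    also have "\<dots> \<le> (LINT x|lebesgue. indicat_real ?K x * \<bar>indicat_real (En n) x - indicat_real E x\<bar>)"
      by (rule integral_mono[OF integrable_norm[OF Bochner_Integration.integrable_diff[OF i1 i2]] i3])
        (auto simp: indicator_def)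
    finally show ?thesis by (simp add: set_lebesgue_integral_def)
  qed
  have "?d \<longlonglongrightarrow> 0" using lim by (simp add: L1loc_tendsto_def)
  then have "(\<lambda>n. measure lebesgue (En n \<inter> ball 0 R) - measure lebesgue (E \<inter> ball 0 R)) \<longlonglongrightarrow> 0"
    by (rule Lim_null_comparison[OF always_eventually, rotated]) (use bound in blast)
  then show ?thesis by (rule LIM_zero_cancel)
qed

text \<open>After the translation is undone, the distance to the empty set on \<open>K\<close> is
  the mass of \<open>E\<close> in \<open>K\<close> shifted by \<open>z n\<close>. Every fixed point
  eventually lies outside the shifted \<open>K\<close>, and the indicator of \<open>E\<close>
  dominates. This serves to find the sign of the energy of the empty set.\<close>

lemma L1loc_tendsto_escaping:
  fixes E :: "(real^'d::finite) set"
  assumes E: "E \<in> lmeasurable" and z: "filterlim (\<lambda>n. norm (z n)) at_top sequentially"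
  shows "L1loc_tendsto (\<lambda>n. (\<lambda>x. x - z n) ` E) {}"
  unfolding L1loc_tendsto_def
proof (intro allI impI)
  fix K :: "(real^'d) set" assume K: "compact K"
  then obtain B where B: "\<And>x. x \<in> K \<Longrightarrow> norm x \<le> B" by (meson compact_imp_bounded bounded_iff)
  have Es: "E \<in> sets lebesgue" using E by blast
  have Km: "K \<in> lmeasurable" using K by (rule lmeasurable_compact)
  let ?f = "\<lambda>n x. indicat_real E x * indicat_real ((\<lambda>x. x + z n) ` K) x"
  have eq: "(LINT x:K|lebesgue. \<bar>indicat_real ((\<lambda>x. x - z n) ` E) x - indicat_real {} x\<bar>)
      = (LINT x|lebesgue. ?f n x)" for n
  proof -
    have "(LINT x:K|lebesgue. \<bar>indicat_real ((\<lambda>x. x - z n) ` E) x - indicat_real {} x\<bar>)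
       = (LINT x|lebesgue. indicat_real (K \<inter> (\<lambda>x. x - z n) ` E) x)"
      unfolding set_lebesgue_integral_def
      by (rule Bochner_Integration.integral_cong) (auto simp: indicator_def)
    also have "\<dots> = measure lebesgue (K \<inter> (\<lambda>x. x - z n) ` E)" by simp
    also have "K \<inter> (\<lambda>x. x - z n) ` E = (\<lambda>x. x - z n) ` (E \<inter> (\<lambda>x. x + z n) ` K)" 
      by (auto simp: image_iff) force
    also have "measure lebesgue \<dots> = measure lebesgue (E \<inter> (\<lambda>x. x + z n) ` K)"
      by (rule measure_translation_subtract)
    also have "\<dots> = (LINT x|lebesgue. ?f n x)"
      by (simp flip: indicator_inter_arith)
    finally show ?thesis .
  qed
  have meas: "?f n \<in> borel_measurable lebesgue" for n
    using Es shift_in_lebesgue[OF fmeasurableD[OF Km]]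
    by (intro borel_measurable_times borel_measurable_indicator) auto
  have ptw: "AE x in lebesgue. (\<lambda>n. ?f n x) \<longlonglongrightarrow> 0"
  proof (rule AE_I2)
    fix x :: "real^'d"
    have "eventually (\<lambda>n. norm (z n) \<ge> norm x + B + 1) sequentially"
      using z by (simp add: filterlim_at_top)
    then have "eventually (\<lambda>n. ?f n x = 0) sequentially"
    proof eventually_elim
      case (elim n)
      have "x \<notin> (\<lambda>x. x + z n) ` K"
      proof
        assume "x \<in> (\<lambda>x. x + z n) ` K"
        then have "x - z n \<in> K" by auto
        then have "norm (x - z n) \<le> B" by (rule B)
        then show False using elim norm_triangle_ineq4[of x "x - z n"] by simp
      qed
      then show ?case by simp
    qed
    then show "(\<lambda>n. ?f n x) \<longlonglongrightarrow> 0" by (rule tendsto_eventually)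
  qed
  have bnd: "AE x in lebesgue. norm (?f n x) \<le> indicat_real E x" for n
    by (simp add: indicator_def)
  have "(\<lambda>n. LINT x|lebesgue. ?f n x) \<longlonglongrightarrow> (LINT x|(lebesgue::(real^'d) measure). (0::real))"
    by (rule integral_dominated_convergence[OF _ meas _ ptw bnd])
      (use E in \<open>auto simp: lmeasurable_iff_integrable\<close>)
  then show "(\<lambda>n. LINT x:K|lebesgue. \<bar>indicat_real ((\<lambda>x. x - z n) ` E) x - indicat_real {} x\<bar>) \<longlonglongrightarrow> 0"
    unfolding eq by simp
qed

section \<open>Uniform tightness of sets of bounded perimeter\<close>

lemma countable_cubic_lattice: "countable (cubic_lattice a :: (real^'d::finite) set)"
proof (rule countable_subset)
  show "(cubic_lattice a :: (real^'d) set) \<subseteq> (\<lambda>f. \<chi> k. a * of_int (f k)) ` (UNIV :: ('d \<Rightarrow> int) set)"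
  proof
    fix v :: "real^'d" assume "v \<in> cubic_lattice a"
    then obtain f where "\<And>k. v $ k = a * of_int (f k :: int)"
      unfolding cubic_lattice_def by (auto) metis
    then have "v = (\<chi> k. a * of_int (f k))" by (simp add: vec_eq_iff)
    then show "v \<in> (\<lambda>f. \<chi> k. a * of_int (f k)) ` (UNIV :: ('d \<Rightarrow> int) set)" by blast
  qed
  have "countable (PiE (UNIV :: 'd set) (\<lambda>_. UNIV :: int set))"
    by (intro countable_PiE) auto
  then show "countable ((\<lambda>f. \<chi> k. a * of_int (f k) :: real^'d) ` (UNIV :: ('d \<Rightarrow> int) set))"
    by (simp add: PiE_UNIV_domain)
qed

text \<open>Overlap costs only a constant factor: the balls split into classes of disjoint ones, and
  the number of classes is the same for all \<open>T\<close>, \<open>g\<close> and \<open>c\<close>.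
  The function \<open>g\<close> is left free because the bound is used once for the masses in the
  balls and once for their isoperimetric terms. The shift \<open>h\<close> will move lattice points
  to cell centers.\<close>

lemma lattice_ball_overlap:
  fixes h :: "real^'d::finite"
  assumes a: "0 < a"
  shows "\<exists>K::nat. \<forall>T (g :: real^'d \<Rightarrow> real) c.
     finite T \<longrightarrow> T \<subseteq> cubic_lattice a \<longrightarrow>
     (\<forall>T'\<subseteq>T. disjoint_family_on (\<lambda>v. ball (v + h) (a * sqrt (real CARD('d)) / 2)) T' \<longrightarrow> sum g T' \<le> c)
     \<longrightarrow> sum g T \<le> real K * c"
proof -
  define N where "N = int CARD('d)"
  \<comment> \<open>Lattice points congruent modulo \<open>N\<close> have disjoint balls: colour by residues.\<close>
  define col where "col = (\<lambda>v::real^'d. \<lambda>k. \<lfloor>v $ k / a\<rfloor> mod N)"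
  define C where "C = (UNIV :: 'd set) \<rightarrow>\<^sub>E {0..<N}"
  have N: "N > 0" by (simp add: N_def)
  have C: "finite C" unfolding C_def by (intro finite_PiE) auto
  have colC: "col v \<in> C" for v using N by (auto simp: col_def C_def)
  have disj: "ball (v + h) (a * sqrt (real CARD('d)) / 2) \<inter> ball (w + h) (a * sqrt (real CARD('d)) / 2) = {}"
    if v: "v \<in> cubic_lattice a" and w: "w \<in> cubic_lattice a" and "v \<noteq> w" "col v = col w" for v w
  proof -
    obtain k where k: "v $ k \<noteq> w $ k" using \<open>v \<noteq> w\<close> by (auto simp: vec_eq_iff)
    obtain x where x: "v $ k = a * of_int x" using v unfolding cubic_lattice_def by blast
    obtain y where y: "w $ k = a * of_int y" using w unfolding cubic_lattice_def by blast
    have "x mod N = y mod N"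
      using fun_cong[OF \<open>col v = col w\<close>, of k] a by (simp add: col_def x y)
    then have "N dvd x - y" by (simp add: mod_eq_dvd_iff)
    moreover have "x - y \<noteq> 0" using k x y by auto
    ultimately have "N \<le> \<bar>x - y\<bar>" using dvd_imp_le_int[of "x - y" N] N by simp
    then have "real CARD('d) \<le> \<bar>of_int x - of_int y\<bar>" unfolding N_def by linarith
    \<comment> \<open>Disjointness needs centers at distance at least twice the radius, which is
      \<open>a * sqrt d\<close>; the residues give \<open>a * d\<close>, which is at least as
      large.\<close>
    moreover have "sqrt (real CARD('d)) \<le> real CARD('d)"
      by (intro real_le_lsqrt) (auto simp: power2_eq_square)
    ultimately have "sqrt (real CARD('d)) \<le> \<bar>of_int x - of_int y\<bar>" by linarith
    then have "a * sqrt (real CARD('d)) \<le> a * \<bar>of_int x - of_int y\<bar>"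
      using a by simp
    also have "\<dots> = \<bar>(v - w) $ k\<bar>" using a by (simp add: x y abs_mult flip: right_diff_distrib)
    also have "\<dots> \<le> norm (v - w)" by (rule component_le_norm_cart)
    also have "\<dots> = dist (v + h) (w + h)" by (simp add: dist_norm)
    finally show ?thesis by (intro disjoint_ballI) simp
  qed
  have "sum g T \<le> real (card C) * c"
    if T: "finite T" "T \<subseteq> cubic_lattice a"
      and c: "\<forall>T'\<subseteq>T. disjoint_family_on (\<lambda>v. ball (v + h) (a * sqrt (real CARD('d)) / 2)) T' \<longrightarrow> sum g T' \<le> c"
    for T c and g :: "real^'d \<Rightarrow> real"
  proof -
    have "sum g T = (\<Sum>j\<in>C. sum g {v \<in> T. col v = j})"
      using T C colC by (intro sum.group[symmetric]) auto
    also have "\<dots> \<le> (\<Sum>j\<in>C. c)"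
    proof (rule sum_mono)
      fix j
      have "disjoint_family_on (\<lambda>v. ball (v + h) (a * sqrt (real CARD('d)) / 2)) {v \<in> T. col v = j}"
        using disj T(2) unfolding disjoint_family_on_def by blast
      then show "sum g {v \<in> T. col v = j} \<le> c" using c by auto
    qed
    finally show ?thesis by simp
  qed
  then show ?thesis by blast
qed

text \<open>The half-open cell with lowest corner \<open>v\<close> lies in the open ball except for
  \<open>v\<close> itself. Off the lattice some coordinate of \<open>x\<close> differs from that of
  \<open>v\<close>, so it is strictly closer than \<open>a / 2\<close> to the center, and this one
  strict inequality makes the sum of squares strictly smaller.\<close>

lemma in_circumscribed_ball:
  fixes x :: "real^'d::finite"
  assumes a: "0 < a" and x: "x \<notin> cubic_lattice a"
  obtains v where "v \<in> cubic_lattice a" "x \<in> ball (v + (\<chi> k. a / 2)) (a * sqrt (real CARD('d)) / 2)"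
proof
  define v :: "real^'d" where "v = (\<chi> k. a * of_int \<lfloor>x $ k / a\<rfloor>)"
  show v: "v \<in> cubic_lattice a" by (auto simp: v_def cubic_lattice_def)
  let ?y = "x - (v + (\<chi> k. a / 2))"
  have bounds: "v $ k \<le> x $ k" "x $ k < v $ k + a" for k
  proof -
    show "v $ k \<le> x $ k" "x $ k < v $ k + a"
      using floor_divide_lower[OF a, of "x $ k"] floor_divide_upper[OF a, of "x $ k"]
      by (simp_all add: v_def algebra_simps)
  qed
  have yk: "?y $ k = x $ k - v $ k - a / 2" for k by simp
  have le: "(?y $ k)\<^sup>2 \<le> (a / 2)\<^sup>2" for k
  proof (rule power2_le_iff_abs_le[THEN iffD2])
    show "\<bar>?y $ k\<bar> \<le> a / 2" using bounds[of k] unfolding yk by linarith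
  qed (use a in simp)
  obtain k where "x $ k \<noteq> v $ k" using x v by (metis vec_eq_iff)
  then have "\<bar>?y $ k\<bar> < a / 2" using bounds[of k] unfolding yk by linarith
  then have "(?y $ k)\<^sup>2 < (a / 2)\<^sup>2"
    by (metis abs_ge_zero power2_abs power_strict_mono zero_less_numeral)
  then have "(\<Sum>k\<in>UNIV. (?y $ k)\<^sup>2) < (\<Sum>k\<in>(UNIV::'d set). (a / 2)\<^sup>2)"
    using le by (intro sum_strict_mono_ex1) auto
  then have "norm ?y < sqrt (real CARD('d) * (a / 2)\<^sup>2)"
    by (simp add: norm_vec_def L2_set_def)
  also have "\<dots> = a * sqrt (real CARD('d)) / 2" using a by (simp add: real_sqrt_mult)
  finally show "x \<in> ball (v + (\<chi> k. a / 2)) (a * sqrt (real CARD('d)) / 2)"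
    by (simp add: dist_norm norm_minus_commute)
qed

text \<open>Finite unions along an enumeration increase to the whole union, so a uniform bound
  passes to the limit. It will be applied to the light balls, which are controlled on finite
  subfamilies.\<close>

lemma emeasure_countable_UN_le:
  assumes I: "countable I" and A: "\<And>i. i \<in> I \<Longrightarrow> A i \<in> sets M"
    and le: "\<And>T. finite T \<Longrightarrow> T \<subseteq> I \<Longrightarrow> emeasure M (\<Union>i\<in>T. A i) \<le> c"
  shows "emeasure M (\<Union>i\<in>I. A i) \<le> c"
proof (cases "I = {}")
  case False
  define U where "U = (\<lambda>n. \<Union>k<n. A (from_nat_into I k))"
  have e: "from_nat_into I k \<in> I" for k using False by (rule from_nat_into)
  have "(\<Union>i\<in>I. A i) = (\<Union>k. A (from_nat_into I k))"
    using range_from_nat_into[OF False I] by (metis image_image)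
  also have "\<dots> = (\<Union>n. U n)"
    unfolding U_def by blast
  also have "emeasure M \<dots> = (SUP n. emeasure M (U n))"
  proof (rule SUP_emeasure_incseq[symmetric])
    show "range U \<subseteq> sets M" using A e by (auto simp: U_def)
    show "incseq U" unfolding U_def incseq_def by (intro allI impI UN_mono) auto
  qed
  also have "\<dots> \<le> c"
  proof (rule SUP_least)
    fix n
    have "U n = (\<Union>i\<in>from_nat_into I ` {..<n}. A i)" by (simp add: U_def)
    then show "emeasure M (U n) \<le> c" using le[of "from_nat_into I ` {..<n}"] e by auto
  qed
  finally show ?thesis .
qed (use le[of "{}"] in simp)

lemma perimeter_mono:
  assumes "perimeter_set_operations P" "E \<in> sets lebesgue" "open U" "open U'" "U \<subseteq> U'"
  shows "P E U \<le> P E U'"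
  using assms(1)[unfolded perimeter_set_operations_def, rule_format, OF assms(2), THEN conjunct1] assms(3-)
  by simp

lemma perimeter_disjoint_union:
  assumes "perimeter_set_operations P" "E \<in> sets lebesgue"
    and "\<And>i. i \<in> {1..I::nat} \<Longrightarrow> open (U i)" "disjoint_family_on U {1..I}"
  shows "(\<Sum>i=1..I. P E (U i)) \<le> P E (\<Union>i\<in>{1..I}. U i)"
  using assms(1)[unfolded perimeter_set_operations_def, rule_format, OF assms(2), THEN conjunct2] assms(3-)
  by simp

lemma perimeter_sum_le:
  fixes P :: "'d::finite rel_functional"
  assumes P: "perimeter_set_operations P" and E: "E \<in> sets lebesgue" and T: "finite T"
    and U: "\<And>v. v \<in> T \<Longrightarrow> open (U v)" "disjoint_family_on U T"
  shows "(\<Sum>v\<in>T. P E (U v)) \<le> P E UNIV"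
proof -
  obtain h where h: "bij_betw h {1..card T} T" using ex_bij_betw_nat_finite_1[OF T] by blast
  have ho: "open (U (h i))" if "i \<in> {1..card T}" for i
    using that h U(1) bij_betwE by blast
  have hd: "disjoint_family_on (\<lambda>i. U (h i)) {1..card T}"
    unfolding disjoint_family_on_def
  proof (intro ballI impI)
    fix i j assume "i \<in> {1..card T}" "j \<in> {1..card T}" "i \<noteq> j"
    then have "h i \<in> T" "h j \<in> T" "h i \<noteq> h j"
      using bij_betwE[OF h] inj_on_eq_iff[OF bij_betw_imp_inj_on[OF h]] by blast+
    then show "U (h i) \<inter> U (h j) = {}" using U(2) unfolding disjoint_family_on_def by blast
  qed
  have "(\<Sum>v\<in>T. P E (U v)) = (\<Sum>i=1..card T. P E (U (h i)))"
    by (rule sum.reindex_bij_betw[OF h, symmetric])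
  also have "\<dots> \<le> P E (\<Union>i\<in>{1..card T}. U (h i))"
    by (rule perimeter_disjoint_union[OF P E ho hd])
  also have "\<dots> \<le> P E UNIV"
    by (rule perimeter_mono[OF P E]) (use ho in auto)
  finally show ?thesis .
qed

text \<open>Lattice points are heavy if their ball holds mass at least \<open>\<delta>\<close>, and
  light otherwise. Bounded overlap and the mass bound \<open>M\<close> limit the number of heavy
  ones, independently of \<open>E\<close>. In a light ball a given mass costs much perimeter, so the
  perimeter bound \<open>C\<close> leaves the light balls at most mass \<open>\<epsilon>\<close>
  together.\<close>

lemma uniform_tightness:
  fixes P :: "'d::finite rel_functional"
  assumes iso: "relative_isoperimetric r0 f1 P" and r1: "0 < r1" "r1 \<le> 2 * r0 / sqrt (real CARD('d))"
    and P: "perimeter_set_operations P"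
    and Ppos: "\<And>E U. E \<in> sets lebesgue \<Longrightarrow> U \<in> sets lebesgue \<Longrightarrow> 0 \<le> P E U"
    and "0 < \<epsilon>" and "0 \<le> M" and "0 \<le> C"
  shows "\<exists>N. \<forall>E\<in>sets lebesgue. emeasure lebesgue E \<le> ennreal M \<longrightarrow> P E UNIV \<le> ereal C \<longrightarrow>
    (\<exists>S\<subseteq>cubic_lattice r1. finite S \<and> card S \<le> N \<and>
      measure lebesgue (E - (\<Union>v\<in>S. ball v (r1 * sqrt (real CARD('d)) / 2 + norm (\<chi> k::'d. r1 / 2)))) \<le> \<epsilon>)"
proof -
  define h :: "real^'d" where "h = (\<chi> k. r1 / 2)"
  define \<rho> where "\<rho> = r1 * sqrt (real CARD('d)) / 2"
  define B where "B = (\<lambda>v. ball (v + h) \<rho>)"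
  \<comment> \<open>The balls \<open>B v\<close> sit at cell centers, the conclusion uses balls
    about lattice points; the summand \<open>norm h\<close> absorbs the shift.\<close>
  define D where "D = \<rho> + norm h"
  \<comment> \<open>The assumed upper bound on \<open>r1\<close> says that the circumscribed radius
    is admissible in the isoperimetric inequality.\<close>
  have \<rho>: "0 < \<rho>" "\<rho> \<le> r0"
    using r1 by (auto simp: \<rho>_def field_simps)
  obtain K where K: "\<And>T (g :: real^'d \<Rightarrow> real) c.
     finite T \<Longrightarrow> T \<subseteq> cubic_lattice r1 \<Longrightarrow> 
     (\<And>T'. T' \<subseteq> T \<Longrightarrow> disjoint_family_on B T' \<Longrightarrow> sum g T' \<le> c) \<Longrightarrow> sum g T \<le> real K * c"
    using lattice_ball_overlap[OF r1(1), of h] unfolding B_def \<rho>_def by blast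
  define \<beta> where "\<beta> = measure lebesgue (ball 0 \<rho> :: (real^'d) set)"
  have \<beta>: "\<beta> > 0" using content_ball_pos[OF \<rho>(1), of "0::real^'d"] by (simp add: \<beta>_def)
  have \<beta>B: "measure lebesgue (B v) = \<beta>" for v
  proof -
    have "B v = (+) (v + h) ` ball 0 \<rho>"
      using ball_translation[of "v + h" 0 \<rho>] unfolding B_def by simp
    then show ?thesis unfolding \<beta>_def by (simp only: measure_translation)
  qed
  have f1: "mono_on {0..} f1" "f1 0 = 0"
    and lim: "filterlim (\<lambda>t. f1 t / t) at_top (at_right 0)"
    using iso by (auto simp: relative_isoperimetric_def)
  \<comment> \<open>With this slope the light balls hold mass at most
    \<open>K * C / \<kappa>\<close>, hence at most \<open>\<epsilon>\<close>. The summand 1 keeps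
    \<open>\<kappa>\<close> positive when \<open>C\<close> is 0.\<close>
  define \<kappa> where "\<kappa> = K * C / \<epsilon> + 1"
  have \<kappa>: "\<kappa> > 0" "K * C \<le> \<epsilon> * \<kappa>" 
    using \<open>0 < \<epsilon>\<close> \<open>0 \<le> C\<close> by (auto simp: \<kappa>_def field_simps add_pos_nonneg add_nonneg_pos)
  obtain \<delta>0 where \<delta>0: "\<delta>0 > 0" "\<And>t. 0 < t \<Longrightarrow> t < \<delta>0 \<Longrightarrow> \<kappa> \<le> f1 t / t"
    using lim unfolding filterlim_at_top eventually_at_right_field by blast
  \<comment> \<open>Below \<open>\<delta>0\<close> the slope \<open>f1 t / t\<close> is at least
    \<open>\<kappa>\<close>. Below \<open>\<beta> / 2\<close> the part of the ball outside
    \<open>E\<close> is the larger one, so by monotonicity the minimum in the isoperimetric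
    inequality is the term of \<open>E\<close>.\<close>
  define \<delta> where "\<delta> = min \<delta>0 (\<beta> / 2)"
  have \<delta>: "\<delta> > 0" using \<delta>0 \<beta> by (simp add: \<delta>_def)
  show ?thesis
  proof (intro exI[of _ "nat \<lceil>K * M / \<delta>\<rceil>"] ballI impI)
    fix E :: "(real^'d) set"
    assume E: "E \<in> sets lebesgue" and EM: "emeasure lebesgue E \<le> ennreal M" and PC: "P E UNIV \<le> ereal C"
    have Ef: "E \<in> lmeasurable" using E EM by (intro fmeasurableI) (auto simp: ennreal_less_top le_less_trans)
    define b where "b = (\<lambda>v. measure lebesgue (E \<inter> B v))"
    define S where "S = {v \<in> cubic_lattice r1. \<delta> \<le> b v}"
    have EBf: "E \<inter> B v \<in> lmeasurable" for v
      unfolding B_def using Ef by (intro fmeasurable_Int_fmeasurable) auto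
    have measure_disj: "sum b T \<le> M" if T: "finite T" "disjoint_family_on B T" for T
    proof -
      have "sum b T = measure lebesgue (\<Union>v\<in>T. E \<inter> B v)"
        unfolding b_def
      proof (rule measure_finite_Union[OF T(1), symmetric])
        show "(\<lambda>v. E \<inter> B v) ` T \<subseteq> sets lebesgue" using EBf by (blast dest: fmeasurableD)
        show "disjoint_family_on (\<lambda>v. E \<inter> B v) T"
          using T(2) unfolding disjoint_family_on_def by blast
        show "emeasure lebesgue (E \<inter> B v) \<noteq> \<infinity>" for v using fmeasurableD2[OF EBf] by simp
      qed
      also have "\<dots> \<le> measure lebesgue E"
        using Ef by (intro measure_mono_fmeasurable) (use E T in \<open>auto simp: B_def intro!: sets.Int sets.finite_UN\<close>)
      also have "\<dots> \<le> M" using EM \<open>0 \<le> M\<close> by (simp add: emeasure_eq_measure2[OF Ef])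
      finally show ?thesis .
    qed
    have "finite S \<and> card S \<le> nat \<lceil>K * M / \<delta>\<rceil>"
    proof (rule finite_if_finite_subsets_card_bdd)
      fix T assume T: "T \<subseteq> S" "finite T"
      have "card T * \<delta> \<le> sum b T"
        using T by (intro sum_bounded_below) (auto simp: S_def)
      also have "\<dots> \<le> K * M"
        using T by (intro K measure_disj) (auto simp: S_def intro: finite_subset)
      finally have "real (card T) \<le> K * M / \<delta>" using \<delta> by (simp add: field_simps)
      then show "card T \<le> nat \<lceil>K * M / \<delta>\<rceil>" by linarith
    qed
    moreover have "measure lebesgue (E - (\<Union>v\<in>S. ball v D)) \<le> \<epsilon>"
    proof -
      have light: "\<kappa> * b v \<le> f1 (b v) \<and> ereal (f1 (b v)) \<le> P E (B v)" if v: "v \<in> cubic_lattice r1 - S" for v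
      proof -
        have bv: "b v < \<delta>" "0 \<le> b v" using v by (auto simp: S_def b_def)
        have "\<kappa> * b v \<le> f1 (b v)"
        proof (cases "b v = 0")
          case False
          then have "\<kappa> \<le> f1 (b v) / b v" using bv by (intro \<delta>0) (auto simp: \<delta>_def)
          then show ?thesis using False bv by (simp add: field_simps)
        qed (simp add: f1)
        moreover have "measure lebesgue (B v - E) = \<beta> - b v"
        proof -
          have "B v - E = B v - (E \<inter> B v)" by blast
          moreover have "measure lebesgue (B v - (E \<inter> B v)) = measure lebesgue (B v) - measure lebesgue (E \<inter> B v)"
            using EBf by (intro measurable_measure_Diff) (auto simp: B_def)
          ultimately show ?thesis by (simp add: \<beta>B b_def)
        qed
        then have "f1 (b v) \<le> f1 (measure lebesgue (B v - E))"
          using bv by (intro mono_onD[OF f1(1)]) (auto simp: \<delta>_def)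
        moreover have "ereal (min (f1 (measure lebesgue (E \<inter> B v))) (f1 (measure lebesgue (B v - E)))) \<le> P E (B v)"
          using iso E \<rho> unfolding relative_isoperimetric_def B_def by blast
        ultimately show ?thesis by (simp add: b_def min_def)
      qed
      have fin: "emeasure lebesgue (\<Union>v\<in>T. E \<inter> B v) \<le> ennreal \<epsilon>"
        if T: "finite T" "T \<subseteq> cubic_lattice r1 - S" for T
      proof -
        have "(\<Sum>v\<in>T. f1 (b v)) \<le> K * C"
        proof (rule K)
          fix T' assume T': "T' \<subseteq> T" "disjoint_family_on B T'"
          have "ereal (\<Sum>v\<in>T'. f1 (b v)) = (\<Sum>v\<in>T'. ereal (f1 (b v)))" by simp
          also have "\<dots> \<le> (\<Sum>v\<in>T'. P E (B v))"
            using T T' light by (intro sum_mono) auto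
          also have "\<dots> \<le> P E UNIV"
            using T T' by (intro perimeter_sum_le P E) (auto simp: B_def intro: finite_subset)
          also note PC
          finally show "(\<Sum>v\<in>T'. f1 (b v)) \<le> C" by simp
        qed (use T in auto)
        moreover have "(\<Sum>v\<in>T. \<kappa> * b v) \<le> (\<Sum>v\<in>T. f1 (b v))"
          using T light by (intro sum_mono) auto
        ultimately have "\<kappa> * sum b T \<le> \<kappa> * \<epsilon>"
          using \<kappa> by (simp add: sum_distrib_left mult.commute)
        then have "sum b T \<le> \<epsilon>" using \<kappa>(1) by simp
        have "emeasure lebesgue (\<Union>v\<in>T. E \<inter> B v) \<le> (\<Sum>v\<in>T. emeasure lebesgue (E \<inter> B v))"
          using T EBf by (intro emeasure_subadditive_finite) auto
        also have "\<dots> = ennreal (sum b T)"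
          unfolding b_def using EBf by (simp add: emeasure_eq_measure2 sum_ennreal)
        also have "\<dots> \<le> ennreal \<epsilon>" using \<open>sum b T \<le> \<epsilon>\<close> by (rule ennreal_leI)
        finally show ?thesis .
      qed
      \<comment> \<open>The covering by open circumscribed balls was shown off the lattice only; the
        lattice is countable, hence negligible.\<close>
      have null: "cubic_lattice r1 \<in> null_sets (lebesgue :: (real^'d) measure)"
        using countable_cubic_lattice countable_imp_null_set_lborel null_sets_completionI by blast
      have BD: "B v \<subseteq> ball v D" for v
      proof
        fix x assume "x \<in> B v"
        then have "dist (v + h) x < \<rho>" by (simp add: B_def)
        moreover have "dist v (v + h) = norm h" by (simp add: dist_norm)
        ultimately show "x \<in> ball v D" using dist_triangle[of v x "v + h"] by (simp add: D_def)
      qed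
      have "E - (\<Union>v\<in>S. ball v D) \<subseteq> (\<Union>v\<in>cubic_lattice r1 - S. E \<inter> B v) \<union> cubic_lattice r1"
      proof
        fix x assume x: "x \<in> E - (\<Union>v\<in>S. ball v D)"
        show "x \<in> (\<Union>v\<in>cubic_lattice r1 - S. E \<inter> B v) \<union> cubic_lattice r1"
        proof (cases "x \<in> cubic_lattice r1")
          case False
          obtain v where v: "v \<in> cubic_lattice r1" "x \<in> B v"
            using in_circumscribed_ball[OF r1(1) False] unfolding B_def h_def \<rho>_def by blast
          then have "v \<notin> S" using x BD by blast
          then show ?thesis using v x by blast
        qed simp
      qed
      moreover have ctb: "countable (cubic_lattice r1 - S)"
        by (rule countable_subset[OF Diff_subset countable_cubic_lattice])
      have EBs: "E \<inter> B v \<in> sets lebesgue" for v using EBf by (rule fmeasurableD)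
      have UNs: "(\<Union>v\<in>cubic_lattice r1 - S. E \<inter> B v) \<in> sets lebesgue"
        using ctb EBs by (rule sets.countable_UN'')
      moreover have "(\<Union>v\<in>cubic_lattice r1 - S. E \<inter> B v) \<union> cubic_lattice r1 \<in> sets lebesgue"
        by (rule sets.Un[OF UNs null_setsD2[OF null]])
      ultimately have "emeasure lebesgue (E - (\<Union>v\<in>S. ball v D))
          \<le> emeasure lebesgue ((\<Union>v\<in>cubic_lattice r1 - S. E \<inter> B v) \<union> cubic_lattice r1)"
        by (intro emeasure_mono)
      also have "\<dots> = emeasure lebesgue (\<Union>v\<in>cubic_lattice r1 - S. E \<inter> B v)"
        by (rule emeasure_Un_null_set[OF UNs null])
      also have "\<dots> \<le> ennreal \<epsilon>"
        by (rule emeasure_countable_UN_le[OF ctb EBs fin])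
      finally show ?thesis
        using \<open>0 < \<epsilon>\<close> by (simp add: measure_def enn2real_leI)
    qed
    ultimately show "\<exists>S\<subseteq>cubic_lattice r1. finite S \<and> card S \<le> nat \<lceil>K * M / \<delta>\<rceil> \<and>
      measure lebesgue (E - (\<Union>v\<in>S. ball v (r1 * sqrt (real CARD('d)) / 2 + norm (\<chi> k::'d. r1 / 2)))) \<le> \<epsilon>"
      unfolding D_def \<rho>_def h_def by (intro exI[of _ S]) (auto simp: S_def)
  qed
qed

section \<open>Superadditivity of the energy along escaping windows\<close>

lemma sum_liminf_le_liminf_sum:
  fixes u :: "'i \<Rightarrow> nat \<Rightarrow> ereal"
  assumes "finite A" "\<And>i. i \<in> A \<Longrightarrow> liminf (u i) \<noteq> -\<infinity>"
  shows "(\<Sum>i\<in>A. liminf (u i)) \<le> liminf (\<lambda>n. \<Sum>i\<in>A. u i n)"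
  using assms
proof (induction A)
  case (insert a A)
  have IH: "(\<Sum>i\<in>A. liminf (u i)) \<le> liminf (\<lambda>n. \<Sum>i\<in>A. u i n)" using insert by auto
  have "(\<Sum>i\<in>A. liminf (u i)) \<noteq> -\<infinity>"
    using insert.hyps(1) insert.prems by (induction A) auto
  then have ne: "liminf (\<lambda>n. \<Sum>i\<in>A. u i n) \<noteq> -\<infinity>" using IH by auto
  have "(\<Sum>i\<in>insert a A. liminf (u i)) = liminf (u a) + (\<Sum>i\<in>A. liminf (u i))"
    using insert.hyps by simp
  also have "\<dots> \<le> liminf (u a) + liminf (\<lambda>n. \<Sum>i\<in>A. u i n)"
    using IH by (rule add_left_mono)
  also have "\<dots> \<le> liminf (\<lambda>n. u a n + (\<Sum>i\<in>A. u i n))"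
    using ne insert.prems[of a] by (intro ereal_liminf_add_mono) auto
  finally show ?case using insert.hyps by simp
qed (simp add: Liminf_const)

lemma tendsto_sum_ereal_not_MInf:
  fixes u :: "'i \<Rightarrow> 'a \<Rightarrow> ereal"
  assumes "finite A" "\<And>i. i \<in> A \<Longrightarrow> (u i \<longlongrightarrow> l i) F" "\<And>i. i \<in> A \<Longrightarrow> l i \<noteq> -\<infinity>"
  shows "((\<lambda>n. \<Sum>i\<in>A. u i n) \<longlongrightarrow> (\<Sum>i\<in>A. l i)) F"
  using assms
proof (induction A)
  case (insert a A)
  have "sum l A \<noteq> -\<infinity>" using insert.hyps(1) insert.prems(2) by (induction A) auto
  then have "((\<lambda>n. u a n + (\<Sum>i\<in>A. u i n)) \<longlongrightarrow> l a + sum l A) F"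
    using insert by (intro tendsto_add_ereal_general) auto
  then show ?case using insert.hyps by simp
qed simp

text \<open>Lower limits are superadditive as long as no opposite infinities meet. The values at the
  limit set exceed \<open>-\<infinity>\<close>, and lower semicontinuity transfers this to both
  lower limits.\<close>

lemma lower_semicontinuity_add:
  fixes P V :: "'d::finite rel_functional"
  assumes P: "lower_semicontinuity P" and V: "lower_semicontinuity V"
    and nP: "\<And>E U. E \<in> sets lebesgue \<Longrightarrow> U \<in> sets lebesgue \<Longrightarrow> P E U \<noteq> -\<infinity>"
    and nV: "\<And>E U. E \<in> sets lebesgue \<Longrightarrow> U \<in> sets lebesgue \<Longrightarrow> V E U \<noteq> -\<infinity>"
  shows "lower_semicontinuity (\<lambda>E U. P E U + V E U)"
  unfolding lower_semicontinuity_def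
proof (intro ballI allI impI)
  fix E U :: "(real^'d) set" and En
  assume E: "E \<in> sets lebesgue" and
    h: "open U \<and> bounded U \<and> (\<forall>n. En n \<in> sets lebesgue) \<and> L1loc_tendsto En E \<and> (SUP n. emeasure lebesgue (En n)) < \<infinity>"
  have U: "U \<in> sets lebesgue" using h by simp
  have p: "P E U \<le> liminf (\<lambda>n. P (En n) U)"
    using P[unfolded lower_semicontinuity_def, rule_format, OF E h] .
  have v: "V E U \<le> liminf (\<lambda>n. V (En n) U)"
    using V[unfolded lower_semicontinuity_def, rule_format, OF E h] .
  have "P E U + V E U \<le> liminf (\<lambda>n. P (En n) U) + liminf (\<lambda>n. V (En n) U)"
    using p v by (rule add_mono)
  also have "\<dots> \<le> liminf (\<lambda>n. P (En n) U + V (En n) U)"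
    using p v nP[OF E U] nV[OF E U] by (intro ereal_liminf_add_mono) auto
  finally show "P E U + V E U \<le> liminf (\<lambda>n. P (En n) U + V (En n) U)" .
qed

lemma beppo_levi_add:
  fixes P V :: "'d::finite rel_functional"
  assumes P: "beppo_levi P" and V: "beppo_levi V"
    and nP: "\<And>E U. E \<in> sets lebesgue \<Longrightarrow> U \<in> sets lebesgue \<Longrightarrow> P E U \<noteq> -\<infinity>"
    and nV: "\<And>E U. E \<in> sets lebesgue \<Longrightarrow> U \<in> sets lebesgue \<Longrightarrow> V E U \<noteq> -\<infinity>"
  shows "beppo_levi (\<lambda>E U. P E U + V E U)"
  unfolding beppo_levi_def
proof (intro ballI allI impI)
  fix E :: "(real^'d) set" and U :: "nat \<Rightarrow> (real^'d) set"
  assume U: "(\<forall>n::nat. open (U n)) \<and> incseq U \<and> (\<Union>n. U n) = UNIV" and E: "E \<in> sets lebesgue"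
  show "(\<lambda>n. P E (U n) + V E (U n)) \<longlonglongrightarrow> P E UNIV + V E UNIV"
    using P[unfolded beppo_levi_def, rule_format, OF U E] V[unfolded beppo_levi_def, rule_format, OF U E]
      nP[OF E, of UNIV] nV[OF E, of UNIV]
    by (intro tendsto_add_ereal_general) auto
qed

text \<open>The perimeter is superadditive over disjoint balls without error, so
  \<open>P + V\<close> has the error terms of \<open>V\<close>. The distance \<open>7 * R\<close>
  between centers leaves a gap of \<open>5 * R\<close> after two radii are removed. Windows are
  indexed by an arbitrary finite set, which suits the subfamilies of centers selected later.\<close>

lemma weak_superadditivity_add:
  fixes P V :: "'d::finite rel_functional"
  assumes P: "perimeter_set_operations P" and V: "weak_superadditivity V" and M: "0 < M"
  obtains \<eta>1 \<eta>2 :: "real \<Rightarrow> real" where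
    "continuous_on {0..} \<eta>1" "\<eta>1 0 = 0" "(\<eta>2 \<longlongrightarrow> 0) at_top"
    "\<And>E R (A :: nat set) c. E \<in> sets lebesgue \<Longrightarrow> 0 < R \<Longrightarrow> finite A \<Longrightarrow> A \<noteq> {} \<Longrightarrow>
       emeasure lebesgue E \<le> ennreal M \<Longrightarrow>
       (\<And>i j. i \<in> A \<Longrightarrow> j \<in> A \<Longrightarrow> i \<noteq> j \<Longrightarrow> 7 * R \<le> dist (c i) (c j)) \<Longrightarrow>
       (\<Sum>i\<in>A. P E (ball (c i) R) + V E (ball (c i) R))
         \<le> (P E UNIV + V E UNIV) + (ereal (\<eta>1 (measure lebesgue (E - (\<Union>i\<in>A. ball (c i) R)))) + ereal (\<eta>2 R))"
proof -
  obtain \<eta>1 \<eta>2 :: "real \<Rightarrow> real" where \<eta>: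
    "continuous_on {0..} \<eta>1" "\<eta>1 0 = 0" "(\<eta>2 \<longlongrightarrow> 0) at_top"
    and sup: "\<forall>E\<in>sets lebesgue. \<forall>R>0. \<forall>I\<ge>1::nat. \<forall>c.
           emeasure lebesgue E \<le> ennreal M \<and>
           (\<forall>i\<in>{1..I}. \<forall>j\<in>{1..I}. i \<noteq> j \<longrightarrow> setdist (ball (c i) R) (ball (c j) R) \<ge> 5 * R) \<longrightarrow>
           (\<Sum>i=1..I. V E (ball (c i) R))
             \<le> V E UNIV + ereal (\<eta>1 (measure lebesgue (E - (\<Union>i\<in>{1..I}. ball (c i) R))))
                 + ereal (\<eta>2 R)"
    using V M unfolding weak_superadditivity_def by (elim allE[of _ M] impE) auto
  show thesis
  proof (rule that[OF \<eta>])
    fix E :: "(real^'d) set" and R :: real and A :: "nat set" and c :: "nat \<Rightarrow> real^'d"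
    assume E: "E \<in> sets lebesgue" and R: "0 < R" and A: "finite A" "A \<noteq> {}"
      and EM: "emeasure lebesgue E \<le> ennreal M"
      and sep: "\<And>i j. i \<in> A \<Longrightarrow> j \<in> A \<Longrightarrow> i \<noteq> j \<Longrightarrow> 7 * R \<le> dist (c i) (c j)"
    have Ple: "(\<Sum>i\<in>A. P E (ball (c i) R)) \<le> P E UNIV"
    proof (rule perimeter_sum_le[OF P E A(1)])
      show "disjoint_family_on (\<lambda>i. ball (c i) R) A"
        unfolding disjoint_family_on_def
        using sep R by (intro ballI impI disjoint_ballI) force
    qed simp
    obtain h where h: "bij_betw h {1..card A} A" using ex_bij_betw_nat_finite_1[OF A(1)] by blast
    have hinj: "h i \<noteq> h j" if "i \<in> {1..card A}" "j \<in> {1..card A}" "i \<noteq> j" for i j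
      using inj_on_eq_iff[OF bij_betw_imp_inj_on[OF h] that(1,2)] that(3) by simp
    have sd: "setdist (ball (c (h i)) R) (ball (c (h j)) R) \<ge> 5 * R"
      if "i \<in> {1..card A}" "j \<in> {1..card A}" "i \<noteq> j" for i j
    proof (rule le_setdistI)
      fix x y assume "x \<in> ball (c (h i)) R" "y \<in> ball (c (h j)) R"
      moreover have "7 * R \<le> dist (c (h i)) (c (h j))"
        using that hinj[OF that] bij_betwE[OF h] by (intro sep) auto
      ultimately show "5 * R \<le> dist x y"
        using dist_triangle[of "c (h i)" "c (h j)" x] dist_triangle[of x "c (h j)" y]
        by (simp add: dist_commute)
    qed (use R in auto)
    have img: "(\<Union>i\<in>{1..card A}. ball (c (h i)) R) = (\<Union>i\<in>A. ball (c i) R)"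
      using arg_cong[OF bij_betw_imp_surj_on[OF h], of "\<lambda>S. \<Union>i\<in>S. ball (c i) R"]
      by (simp only: image_image)
    have c1: "1 \<le> card A" using A by (simp add: Suc_le_eq card_gt_0_iff)
    have "(\<Sum>i\<in>A. V E (ball (c i) R)) = (\<Sum>i=1..card A. V E (ball (c (h i)) R))"
      by (rule sum.reindex_bij_betw[OF h, symmetric])
    also have "\<dots> \<le> V E UNIV + ereal (\<eta>1 (measure lebesgue (E - (\<Union>i\<in>{1..card A}. ball (c (h i)) R)))) + ereal (\<eta>2 R)"
      using sup[rule_format, OF E R c1, of "\<lambda>i. c (h i)"] EM sd by simp
    also have "\<dots> = V E UNIV + (ereal (\<eta>1 (measure lebesgue (E - (\<Union>i\<in>A. ball (c i) R)))) + ereal (\<eta>2 R))"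
      unfolding img by (rule add.assoc)
    finally have Vle: "(\<Sum>i\<in>A. V E (ball (c i) R)) \<le> \<dots>" .
    show "(\<Sum>i\<in>A. P E (ball (c i) R) + V E (ball (c i) R))
         \<le> (P E UNIV + V E UNIV) + (ereal (\<eta>1 (measure lebesgue (E - (\<Union>i\<in>A. ball (c i) R)))) + ereal (\<eta>2 R))"
      using add_mono[OF Ple Vle] by (simp only: sum.distrib add.assoc)
  qed
qed

lemma measure_Int_ball_tendsto:
  fixes E :: "(real^'d::finite) set"
  assumes E: "E \<in> sets lebesgue" and le: "\<And>n. measure lebesgue (E \<inter> ball 0 (real n)) \<le> M"
  shows "E \<in> lmeasurable" "(\<lambda>n. measure lebesgue (E \<inter> ball 0 (real n))) \<longlonglongrightarrow> measure lebesgue E"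
proof -
  have m: "E \<inter> ball 0 (real n) \<in> lmeasurable" for n
    using fmeasurable_Int_fmeasurable[OF lmeasurable_ball E] by (simp add: Int_commute)
  have inc: "incseq (\<lambda>n. E \<inter> ball 0 (real n))" by (auto simp: incseq_def)
  have un: "(\<Union>n. E \<inter> ball 0 (real n)) = E"
    using reals_Archimedean2 by (auto simp: set_eq_iff)
  have lim: "(\<lambda>n. emeasure lebesgue (E \<inter> ball 0 (real n))) \<longlonglongrightarrow> emeasure lebesgue E"
    using Lim_emeasure_incseq[OF _ inc, of lebesgue] m un by (auto simp: image_subset_iff)
  have "emeasure lebesgue (E \<inter> ball 0 (real n)) \<le> ennreal M" for n
    using le[of n] by (simp add: emeasure_eq_measure2[OF m] ennreal_leI)
  then have "emeasure lebesgue E \<le> ennreal M"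
    by (intro LIMSEQ_le_const2[OF lim]) auto
  then show Ef: "E \<in> lmeasurable" using E
    by (intro fmeasurableI) (auto simp: le_less_trans)
  show "(\<lambda>n. measure lebesgue (E \<inter> ball 0 (real n))) \<longlonglongrightarrow> measure lebesgue E"
    using lim unfolding measure_def[of lebesgue "E \<inter> _"] emeasure_eq_measure2[OF Ef]
    by (rule tendsto_enn2real) simp
qed

text \<open>Here \<open>H\<close> stands for \<open>P + V\<close>; the limit arguments below treat
  the total energy as one functional. In the applications \<open>M\<close> is also the exact mass of
  the sets.\<close>

locale concentration_setting =
  fixes H :: "'d::finite rel_functional" and r1 M :: real and \<eta>1 \<eta>2 :: "real \<Rightarrow> real"
  assumes not_MInf: "E \<in> sets lebesgue \<Longrightarrow> U \<in> sets lebesgue \<Longrightarrow> H E U \<noteq> -\<infinity>"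
    and periodic: "lattice_periodic r1 H"
    and lsc: "lower_semicontinuity H"
    and exhaust: "beppo_levi H"
    and M_pos: "0 < M"
    and eta: "continuous_on {0..} \<eta>1" "\<eta>1 0 = 0" "(\<eta>2 \<longlongrightarrow> 0) at_top"
    and superadd: "\<And>E R (A :: nat set) c. E \<in> sets lebesgue \<Longrightarrow> 0 < R \<Longrightarrow> finite A \<Longrightarrow> A \<noteq> {} \<Longrightarrow>
       emeasure lebesgue E \<le> ennreal M \<Longrightarrow>
       (\<And>i j. i \<in> A \<Longrightarrow> j \<in> A \<Longrightarrow> i \<noteq> j \<Longrightarrow> 7 * R \<le> dist (c i) (c j)) \<Longrightarrow>
       (\<Sum>i\<in>A. H E (ball (c i) R))
         \<le> H E UNIV + (ereal (\<eta>1 (measure lebesgue (E - (\<Union>i\<in>A. ball (c i) R)))) + ereal (\<eta>2 R))"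
begin

section \<open>Limits seen from finitely many pairwise diverging centers\<close>

context
  fixes En :: "nat \<Rightarrow> (real^'d) set" and z :: "nat \<Rightarrow> nat \<Rightarrow> real^'d"
    and G :: "nat \<Rightarrow> (real^'d) set" and A :: "nat set" and e :: ereal
  assumes En: "\<And>n. En n \<in> sets lebesgue" "\<And>n. emeasure lebesgue (En n) = ennreal M"
    and A: "finite A" "A \<noteq> {}"
    and z: "\<And>i n. i \<in> A \<Longrightarrow> z i n \<in> cubic_lattice r1"
    and div: "\<And>i j. i \<in> A \<Longrightarrow> j \<in> A \<Longrightarrow> i \<noteq> j \<Longrightarrow> filterlim (\<lambda>n. dist (z i n) (z j n)) at_top sequentially"
    and G: "\<And>i. i \<in> A \<Longrightarrow> G i \<in> sets lebesgue"
      "\<And>i. i \<in> A \<Longrightarrow> L1loc_tendsto (\<lambda>n. (\<lambda>x. x - z i n) ` En n) (G i)"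
    and e: "(\<lambda>n. H (En n) UNIV) \<longlonglongrightarrow> e"
begin

lemma En_fm: "En n \<in> lmeasurable" and measure_En: "measure lebesgue (En n) = M"
proof -
  show "En n \<in> lmeasurable" using En by (intro fmeasurableI) auto
  show "measure lebesgue (En n) = M" using En(2)[of n] M_pos by (simp add: measure_def)
qed

lemma recentered_in_sets: "(\<lambda>x. x - z i n) ` En n \<in> sets lebesgue"
  using shift_in_lebesgue[OF En(1)[of n], of "- z i n"] by simp

lemma emeasure_recentered: "emeasure lebesgue ((\<lambda>x. x - z i n) ` En n) = ennreal M"
proof -
  have "(\<lambda>x. x - z i n) ` En n \<in> lmeasurable"
    using En_fm measurable_translation_subtract by blast
  then show ?thesis by (simp add: emeasure_eq_measure2 measure_translation_subtract measure_En)
qed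

lemma measure_balls_tendsto:
  "(\<lambda>n. \<Sum>i\<in>A. measure lebesgue (En n \<inter> ball (z i n) R)) \<longlonglongrightarrow> (\<Sum>i\<in>A. measure lebesgue (G i \<inter> ball 0 R))"
proof (rule tendsto_sum)
  fix i assume "i \<in> A"
  then show "(\<lambda>n. measure lebesgue (En n \<inter> ball (z i n) R)) \<longlonglongrightarrow> measure lebesgue (G i \<inter> ball 0 R)"
    using L1loc_tendsto_measure[OF G(2) recentered_in_sets G(1)] by (simp add: measure_recenter)
qed

lemma eventually_separated:
  "eventually (\<lambda>n. \<forall>i\<in>A. \<forall>j\<in>A. i \<noteq> j \<longrightarrow> R \<le> dist (z i n) (z j n)) sequentially"
proof -
  have "eventually (\<lambda>n. i \<noteq> j \<longrightarrow> R \<le> dist (z i n) (z j n)) sequentially" if "i \<in> A" "j \<in> A" for i j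
    using div[OF that] unfolding filterlim_at_top by (cases "i = j") auto
  then show ?thesis using A by (intro eventually_ball_finite ballI) auto
qed

lemma eventually_measure_outside:
  assumes R: "0 < R"
  shows "eventually (\<lambda>n. measure lebesgue (En n - (\<Union>i\<in>A. ball (z i n) R))
    = M - (\<Sum>i\<in>A. measure lebesgue (En n \<inter> ball (z i n) R))) sequentially"
  using eventually_separated[of "7 * R"]
proof eventually_elim
  case (elim n)
  have fm: "En n \<inter> ball (z i n) R \<in> lmeasurable" for i
    using En_fm by (intro fmeasurable_Int_fmeasurable) auto
  have "(\<Sum>i\<in>A. measure lebesgue (En n \<inter> ball (z i n) R)) = measure lebesgue (\<Union>i\<in>A. En n \<inter> ball (z i n) R)"
  proof (rule measure_finite_Union[OF A(1), symmetric])
    show "(\<lambda>i. En n \<inter> ball (z i n) R) ` A \<subseteq> sets lebesgue" using fm by (blast dest: fmeasurableD)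
    have "ball (z i n) R \<inter> ball (z j n) R = {}" if "i \<in> A" "j \<in> A" "i \<noteq> j" for i j
      using elim that R by (intro disjoint_ballI) force
    then show "disjoint_family_on (\<lambda>i. En n \<inter> ball (z i n) R) A"
      unfolding disjoint_family_on_def by blast
    show "emeasure lebesgue (En n \<inter> ball (z i n) R) \<noteq> \<infinity>" for i using fmeasurableD2[OF fm] by simp
  qed
  moreover have "En n - (\<Union>i\<in>A. ball (z i n) R) = En n - (\<Union>i\<in>A. En n \<inter> ball (z i n) R)" by blast
  moreover have "measure lebesgue (En n - (\<Union>i\<in>A. En n \<inter> ball (z i n) R))
      = measure lebesgue (En n) - measure lebesgue (\<Union>i\<in>A. En n \<inter> ball (z i n) R)"
    using En_fm A by (intro measurable_measure_Diff) (auto intro!: sets.finite_UN fmeasurableD[OF fm] simp del: UN_simps)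
  ultimately show ?case by (simp add: measure_En)
qed

lemma measure_outside_tendsto:
  assumes R: "0 < R"
  shows "(\<lambda>n. measure lebesgue (En n - (\<Union>i\<in>A. ball (z i n) R)))
    \<longlonglongrightarrow> M - (\<Sum>i\<in>A. measure lebesgue (G i \<inter> ball 0 R))"
  using tendsto_diff[OF tendsto_const[of M] measure_balls_tendsto[of R]]
  by (rule Lim_transform_eventually)
    (use eventually_measure_outside[OF R] in \<open>auto elim: eventually_mono\<close>)

text \<open>The mass outside the balls is nonnegative and tends to the difference of the two sides.
  The bound also keeps the arguments of \<open>\<eta>1\<close> in the half-line where it is
  continuous.\<close>

lemma limit_measure_ball_le:
  assumes R: "0 < R"
  shows "(\<Sum>i\<in>A. measure lebesgue (G i \<inter> ball 0 R)) \<le> M"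
  using LIMSEQ_le_const[OF measure_outside_tendsto[OF R], of 0] by auto

lemma limit_lmeasurable:
  assumes i: "i \<in> A"
  shows "G i \<in> lmeasurable"
    "(\<lambda>n. measure lebesgue (G i \<inter> ball 0 (real n))) \<longlonglongrightarrow> measure lebesgue (G i)"
proof -
  have "measure lebesgue (G i \<inter> ball 0 (real n)) \<le> M" for n
  proof (cases "n = 0")
    case False
    have "measure lebesgue (G i \<inter> ball 0 (real n)) \<le> (\<Sum>i\<in>A. measure lebesgue (G i \<inter> ball 0 (real n)))"
      using A i by (intro member_le_sum) auto
    also have "\<dots> \<le> M" using False by (intro limit_measure_ball_le) simp
    finally show ?thesis .
  qed (use M_pos in simp)
  then show "G i \<in> lmeasurable"
    "(\<lambda>n. measure lebesgue (G i \<inter> ball 0 (real n))) \<longlonglongrightarrow> measure lebesgue (G i)"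
    using measure_Int_ball_tendsto[OF G(1)[OF i]] by blast+
qed

lemma limit_measure_tendsto:
  "(\<lambda>n. \<Sum>i\<in>A. measure lebesgue (G i \<inter> ball 0 (real n))) \<longlonglongrightarrow> (\<Sum>i\<in>A. measure lebesgue (G i))"
  by (intro tendsto_sum limit_lmeasurable)

lemma limit_measure_le: "(\<Sum>i\<in>A. measure lebesgue (G i)) \<le> M"
  by (rule LIMSEQ_le_const2[OF limit_measure_tendsto]) (auto intro!: exI[of _ 1] limit_measure_ball_le)

text \<open>Lower semicontinuity bounds each local energy by those of the recentered sets, and
  periodicity turns these into energies of \<open>En n\<close> in windows about the centers. The
  centers are eventually \<open>7 * R\<close> apart, so superadditivity bounds the sum; continuity
  of \<open>\<eta>1\<close> then gives the limit of the error.\<close>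

lemma limit_energy_ball_le:
  assumes R: "0 < R"
  shows "(\<Sum>i\<in>A. H (G i) (ball 0 R))
    \<le> e + (ereal (\<eta>1 (M - (\<Sum>i\<in>A. measure lebesgue (G i \<inter> ball 0 R)))) + ereal (\<eta>2 R))"
proof -
  let ?u = "\<lambda>i n. H ((\<lambda>x. x - z i n) ` En n) (ball 0 R)"
  have lsc': "H (G i) (ball 0 R) \<le> liminf (?u i)" if i: "i \<in> A" for i
    using lsc[unfolded lower_semicontinuity_def, rule_format, OF G(1)[OF i], of "ball 0 R" "\<lambda>n. (\<lambda>x. x - z i n) ` En n"]
      G(2)[OF i] recentered_in_sets
    by (simp add: emeasure_recentered)
  have "(\<Sum>i\<in>A. H (G i) (ball 0 R)) \<le> (\<Sum>i\<in>A. liminf (?u i))"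
    by (rule sum_mono) (rule lsc')
  also have "\<dots> \<le> liminf (\<lambda>n. \<Sum>i\<in>A. ?u i n)"
  proof (rule sum_liminf_le_liminf_sum[OF A(1)])
    fix i assume i: "i \<in> A"
    have "H (G i) (ball 0 R) \<noteq> -\<infinity>" using G(1)[OF i] by (intro not_MInf) auto
    then show "liminf (?u i) \<noteq> -\<infinity>" using lsc'[OF i] by auto
  qed
  also have "\<dots> \<le> liminf (\<lambda>n. H (En n) UNIV + (ereal (\<eta>1 (measure lebesgue (En n - (\<Union>i\<in>A. ball (z i n) R)))) + ereal (\<eta>2 R)))"
  proof (rule Liminf_mono)
    show "eventually (\<lambda>n. (\<Sum>i\<in>A. ?u i n) \<le> H (En n) UNIV + (ereal (\<eta>1 (measure lebesgue (En n - (\<Union>i\<in>A. ball (z i n) R)))) + ereal (\<eta>2 R))) sequentially"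
      using eventually_separated[of "7 * R"]
    proof eventually_elim
      case (elim n)
      have "(\<Sum>i\<in>A. ?u i n) = (\<Sum>i\<in>A. H (En n) (ball (z i n) R))"
        by (intro sum.cong refl lattice_periodic_recenter(1)[OF periodic z En(1)])
      also have "\<dots> \<le> H (En n) UNIV + (ereal (\<eta>1 (measure lebesgue (En n - (\<Union>i\<in>A. ball (z i n) R)))) + ereal (\<eta>2 R))"
        using elim by (intro superadd En A R) (auto simp: En)
      finally show ?case .
    qed
  qed
  also have "\<dots> = e + (ereal (\<eta>1 (M - (\<Sum>i\<in>A. measure lebesgue (G i \<inter> ball 0 R)))) + ereal (\<eta>2 R))"
  proof (rule lim_imp_Liminf)
    have "(\<lambda>n. \<eta>1 (measure lebesgue (En n - (\<Union>i\<in>A. ball (z i n) R))))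
        \<longlonglongrightarrow> \<eta>1 (M - (\<Sum>i\<in>A. measure lebesgue (G i \<inter> ball 0 R)))"
      using limit_measure_ball_le[OF R]
      by (intro continuous_on_tendsto_compose[OF eta(1) measure_outside_tendsto[OF R]]) auto
    from tendsto_ereal[OF tendsto_add[OF this tendsto_const[of "\<eta>2 R"]]]
    have "(\<lambda>n. ereal (\<eta>1 (measure lebesgue (En n - (\<Union>i\<in>A. ball (z i n) R)))) + ereal (\<eta>2 R))
        \<longlonglongrightarrow> ereal (\<eta>1 (M - (\<Sum>i\<in>A. measure lebesgue (G i \<inter> ball 0 R)))) + ereal (\<eta>2 R)"
      by simp
    then show "(\<lambda>n. H (En n) UNIV + (ereal (\<eta>1 (measure lebesgue (En n - (\<Union>i\<in>A. ball (z i n) R)))) + ereal (\<eta>2 R)))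
      \<longlonglongrightarrow> e + (ereal (\<eta>1 (M - (\<Sum>i\<in>A. measure lebesgue (G i \<inter> ball 0 R)))) + ereal (\<eta>2 R))"
      by (rule tendsto_add_ereal_general[OF _ e, rotated]) simp
  qed simp
  finally show ?thesis .
qed

text \<open>The radius tends to infinity: the local energies exhaust the full ones,
  \<open>\<eta>2\<close> vanishes, and the only error left is \<open>\<eta>1\<close> of the mass not
  captured by the family.\<close>

lemma limit_energy_le:
  "(\<Sum>i\<in>A. H (G i) UNIV) \<le> e + ereal (\<eta>1 (M - (\<Sum>i\<in>A. measure lebesgue (G i))))"
proof (rule LIMSEQ_le)
  show "(\<lambda>n. \<Sum>i\<in>A. H (G i) (ball 0 (real n))) \<longlonglongrightarrow> (\<Sum>i\<in>A. H (G i) UNIV)"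
  proof (rule tendsto_sum_ereal_not_MInf[OF A(1)])
    fix i assume i: "i \<in> A"
    have "(\<Union>n. ball (0::real^'d) (real n)) = UNIV"
      using reals_Archimedean2 by (auto simp: set_eq_iff)
    then have U: "(\<forall>n. open (ball (0::real^'d) (real n))) \<and> incseq (\<lambda>n. ball (0::real^'d) (real n))
        \<and> (\<Union>n. ball (0::real^'d) (real n)) = UNIV"
      by (auto simp: incseq_def)
    show "(\<lambda>n. H (G i) (ball 0 (real n))) \<longlonglongrightarrow> H (G i) UNIV"
      by (rule exhaust[unfolded beppo_levi_def, rule_format, OF U G(1)[OF i]])
    show "H (G i) UNIV \<noteq> -\<infinity>" using G(1)[OF i] by (intro not_MInf) auto
  qed
  have "(\<lambda>n. \<eta>1 (M - (\<Sum>i\<in>A. measure lebesgue (G i \<inter> ball 0 (real n)))))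
      \<longlonglongrightarrow> \<eta>1 (M - (\<Sum>i\<in>A. measure lebesgue (G i)))"
  proof (rule continuous_on_tendsto_compose[OF eta(1) tendsto_diff[OF tendsto_const limit_measure_tendsto]])
    show "\<forall>\<^sub>F n in sequentially. M - (\<Sum>i\<in>A. measure lebesgue (G i \<inter> ball 0 (real n))) \<in> {0..}"
      using eventually_gt_at_top[of 0] by eventually_elim (use limit_measure_ball_le in simp)
  qed (use limit_measure_le in simp)
  moreover have "(\<lambda>n. \<eta>2 (real n)) \<longlonglongrightarrow> 0"
    using eta(3) filterlim_real_sequentially by (rule filterlim_compose)
  ultimately have "(\<lambda>n. \<eta>1 (M - (\<Sum>i\<in>A. measure lebesgue (G i \<inter> ball 0 (real n)))) + \<eta>2 (real n))
      \<longlonglongrightarrow> \<eta>1 (M - (\<Sum>i\<in>A. measure lebesgue (G i))) + 0"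
    by (rule tendsto_add)
  then show "(\<lambda>n. e + ereal (\<eta>1 (M - (\<Sum>i\<in>A. measure lebesgue (G i \<inter> ball 0 (real n)))) + \<eta>2 (real n)))
      \<longlonglongrightarrow> e + ereal (\<eta>1 (M - (\<Sum>i\<in>A. measure lebesgue (G i))))"
    by (intro tendsto_add_ereal_general[OF _ tendsto_const] tendsto_ereal) simp_all
  show "\<exists>N. \<forall>n\<ge>N. (\<Sum>i\<in>A. H (G i) (ball 0 (real n)))
     \<le> e + ereal (\<eta>1 (M - (\<Sum>i\<in>A. measure lebesgue (G i \<inter> ball 0 (real n)))) + \<eta>2 (real n))"
    \<comment> \<open>The comparison starts at 1 because the local bound needs a positive
      radius.\<close>
    using limit_energy_ball_le by (intro exI[of _ 1]) (simp flip: plus_ereal.simps(1))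
qed

end

end

section \<open>Extraction of the components\<close>

text \<open>If some sublevel set is infinite, its enumeration is a bounded subsequence. Otherwise
  all sublevel sets are finite and the whole sequence tends to infinity.\<close>

lemma at_top_or_bounded_subseq:
  fixes f :: "nat \<Rightarrow> real"
  obtains r where "strict_mono r"
    "filterlim (\<lambda>n. f (r n)) at_top sequentially \<or> (\<exists>B. eventually (\<lambda>n. f (r n) \<le> B) sequentially)"
proof (cases "\<exists>B. infinite {n. f n \<le> B}")
  case True
  then obtain B where "infinite {n. f n \<le> B}" by blast
  then obtain r :: "nat \<Rightarrow> nat" where "strict_mono r" "\<forall>n. r n \<in> {n. f n \<le> B}"
    using infinite_enumerate by blast
  then show thesis by (intro that[of r] disjI2 exI[of _ B] always_eventually) auto
next
  case False
  have "eventually (\<lambda>n. B \<le> f n) sequentially" for B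
  proof -
    have "finite {n. \<not> B \<le> f n}"
      by (rule finite_subset[of _ "{n. f n \<le> B}"]) (use False in auto)
    then show ?thesis by (simp add: eventually_cofinite flip: cofinite_eq_sequentially)
  qed
  then have "filterlim f at_top sequentially" by (simp add: filterlim_at_top)
  then show thesis by (intro that[of id]) (auto simp: strict_mono_def)
qed

text \<open>
  The list of centers may contain repetitions: it concatenates, for each tolerance \<open>1 / Suc k\<close>,
  a block of fixed length. Duplicates are discarded later, being at bounded distance.
\<close>

lemma centers_of_tight_sequence:
  fixes En :: "nat \<Rightarrow> (real^'d::finite) set"
  assumes En: "\<And>n. En n \<in> lmeasurable"
    and tight: "\<And>\<epsilon>. 0 < \<epsilon> \<Longrightarrow> \<exists>N. \<forall>n. \<exists>S\<subseteq>L. finite S \<and> card S \<le> N \<and>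
      measure lebesgue (En n - (\<Union>v\<in>S. ball v D)) \<le> \<epsilon>"
    and L: "v0 \<in> L"
  obtains z :: "nat \<Rightarrow> nat \<Rightarrow> real^'d" where "\<And>i n. z i n \<in> L"
    "\<And>\<epsilon>. 0 < \<epsilon> \<Longrightarrow> \<exists>I. \<forall>n. measure lebesgue (En n - (\<Union>i<I. ball (z i n) D)) \<le> \<epsilon>"
proof -
  have "\<forall>k. \<exists>N. \<forall>n. \<exists>S\<subseteq>L. finite S \<and> card S \<le> N \<and>
      measure lebesgue (En n - (\<Union>v\<in>S. ball v D)) \<le> 1 / real (Suc k)"
    using tight by simp
  then obtain N where "\<forall>k n. \<exists>S\<subseteq>L. finite S \<and> card S \<le> N k \<and>
      measure lebesgue (En n - (\<Union>v\<in>S. ball v D)) \<le> 1 / real (Suc k)"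
    by metis
  then obtain S where S: "\<And>k n. S k n \<subseteq> L" "\<And>k n. finite (S k n)" "\<And>k n. card (S k n) \<le> N k"
      "\<And>k n. measure lebesgue (En n - (\<Union>v\<in>S k n. ball v D)) \<le> 1 / real (Suc k)"
    by metis
  have "\<exists>g. (\<forall>j. g j \<in> L) \<and> S k n \<subseteq> g ` {..<N k}" for k n
  proof -
    obtain h where h: "bij_betw h {0..<card (S k n)} (S k n)"
      using ex_bij_betw_nat_finite[OF S(2)] by blast
    \<comment> \<open>The enumeration is padded with \<open>v0\<close>, so that the block length
      \<open>N k\<close> does not depend on \<open>n\<close>.\<close>
    let ?g = "\<lambda>j. if j < card (S k n) then h j else v0"
    have "?g j \<in> L" for j using bij_betwE[OF h] S(1)[of k n] L by auto
    moreover have "S k n \<subseteq> ?g ` {..<N k}"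
    proof
      fix x assume "x \<in> S k n"
      then obtain j where j: "j < card (S k n)" "x = h j"
        using bij_betw_imp_surj_on[OF h] by fastforce
      then show "x \<in> ?g ` {..<N k}" using S(3)[of k n] by (intro image_eqI[of _ _ j]) auto
    qed
    ultimately show ?thesis by (intro exI[of _ ?g] conjI allI)
  qed
  then obtain g where g: "\<And>k n j. g k n j \<in> L" "\<And>k n. S k n \<subseteq> g k n ` {..<N k}"
    by metis
  \<comment> \<open>An index codes a tolerance \<open>k\<close> and a position \<open>j\<close> in
    its block. Since only positions below \<open>N k\<close> matter, block \<open>k\<close> lies in
    an initial segment independent of \<open>n\<close>.\<close>
  define z where "z = (\<lambda>i n. g (fst (prod_decode i)) n (snd (prod_decode i)))"
  show thesis
  proof (rule that[of z])
    show "z i n \<in> L" for i n by (simp add: z_def g)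
    fix \<epsilon> :: real assume "0 < \<epsilon>"
    then obtain k where k: "1 / real (Suc k) < \<epsilon>" using nat_approx_posE by blast
    obtain I where I: "(\<lambda>j. prod_encode (k, j)) ` {..<N k} \<subseteq> {..<I}"
      using finite_nat_iff_bounded[of "(\<lambda>j. prod_encode (k, j)) ` {..<N k}"] by auto
    have "measure lebesgue (En n - (\<Union>i<I. ball (z i n) D)) \<le> \<epsilon>" for n
    proof -
      have "S k n \<subseteq> (\<lambda>i. z i n) ` {..<I}"
      proof
        fix v assume "v \<in> S k n"
        then obtain j where "j < N k" "v = g k n j" using g(2) by blast
        then show "v \<in> (\<lambda>i. z i n) ` {..<I}"
          using I by (intro image_eqI[of _ _ "prod_encode (k, j)"]) (auto simp: z_def)
      qed
      then have sub: "En n - (\<Union>i<I. ball (z i n) D) \<subseteq> En n - (\<Union>v\<in>S k n. ball v D)" by blast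
      have "measure lebesgue (En n - (\<Union>i<I. ball (z i n) D)) \<le> measure lebesgue (En n - (\<Union>v\<in>S k n. ball v D))"
      proof (rule measure_mono_fmeasurable[OF sub])
        show "En n - (\<Union>v\<in>S k n. ball v D) \<in> lmeasurable"
          by (rule fmeasurable_Diff[OF En]) (auto intro!: sets.finite_UN S(2))
        show "En n - (\<Union>i<I. ball (z i n) D) \<in> sets lebesgue"
          by (intro sets.Diff fmeasurableD[OF En]) auto
      qed
      also have "\<dots> \<le> \<epsilon>" using S(4)[where n=n and k=k] k by linarith
      finally show ?thesis .
    qed
    then show "\<exists>I. \<forall>n. measure lebesgue (En n - (\<Union>i<I. ball (z i n) D)) \<le> \<epsilon>" by blast
  qed
qed

text \<open>By periodicity recentering keeps the perimeter, so compactness applies at every center;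
  every pair of centers obeys the alternative of \<open>at_top_or_bounded_subseq\<close>. Both
  properties pass to subsequences and ignore finitely many terms, so one diagonal sequence has them
  all.\<close>

lemma extract_limits:
  fixes En :: "nat \<Rightarrow> (real^'d::finite) set" and z :: "nat \<Rightarrow> nat \<Rightarrow> real^'d"
  assumes P: "perimeter_compactness P" and per: "lattice_periodic r1 P"
    and En: "\<And>n. En n \<in> sets lebesgue" and bd: "(SUP n. P (En n) UNIV) < \<infinity>"
    and z: "\<And>i n. z i n \<in> cubic_lattice r1"
  obtains s G where "strict_mono s" "\<And>i. G i \<in> sets lebesgue"
    "\<And>i. L1loc_tendsto (\<lambda>n. (\<lambda>x. x - z i (s n)) ` En (s n)) (G i)"
    "\<And>i j. filterlim (\<lambda>n. dist (z i (s n)) (z j (s n))) at_top sequentially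
      \<or> (\<exists>B. eventually (\<lambda>n. dist (z i (s n)) (z j (s n)) \<le> B) sequentially)"
proof -
  define Q1 where "Q1 = (\<lambda>i s. \<exists>G\<in>sets lebesgue. L1loc_tendsto (\<lambda>n. (\<lambda>x. x - z i (s n)) ` En (s n)) G)"
  define Q2 where "Q2 = (\<lambda>i j s. filterlim (\<lambda>n. dist (z i (s n)) (z j (s n))) at_top sequentially
      \<or> (\<exists>B. eventually (\<lambda>n. dist (z i (s n)) (z j (s n)) \<le> B) sequentially))"
  \<comment> \<open>The number \<open>c\<close> codes a pair \<open>(i, j)\<close> and asks both for
    a limit at \<open>i\<close> and for the alternative at \<open>(i, j)\<close>, so that a single
    countable family of requirements suffices.\<close>
  define Q where "Q = (\<lambda>c s. Q1 (fst (prod_decode c)) s \<and> Q2 (fst (prod_decode c)) (snd (prod_decode c)) s)"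
  have Q1_sub: "Q1 i (s \<circ> r)" if "strict_mono r" "Q1 i s" for i r s
    using that unfolding Q1_def by (auto dest: L1loc_tendsto_subseq)
  have Q2_sub: "Q2 i j (s \<circ> r)" if r: "strict_mono r" and q: "Q2 i j s" for i j r s
    using q unfolding Q2_def
  proof (elim disjE exE)
    assume "filterlim (\<lambda>n. dist (z i (s n)) (z j (s n))) at_top sequentially"
    from filterlim_compose[OF this filterlim_subseq[OF r]]
    show "filterlim (\<lambda>n. dist (z i ((s \<circ> r) n)) (z j ((s \<circ> r) n))) at_top sequentially
      \<or> (\<exists>B. eventually (\<lambda>n. dist (z i ((s \<circ> r) n)) (z j ((s \<circ> r) n)) \<le> B) sequentially)"
      by simp
  next
    fix B assume "eventually (\<lambda>n. dist (z i (s n)) (z j (s n)) \<le> B) sequentially"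
    from eventually_subseq[OF r this]
    show "filterlim (\<lambda>n. dist (z i ((s \<circ> r) n)) (z j ((s \<circ> r) n))) at_top sequentially
      \<or> (\<exists>B. eventually (\<lambda>n. dist (z i ((s \<circ> r) n)) (z j ((s \<circ> r) n)) \<le> B) sequentially)"
      by auto
  qed
  interpret subseqs Q
  proof
    fix c and s :: "nat \<Rightarrow> nat" assume s: "strict_mono s"
    define i j where "i = fst (prod_decode c)" and "j = snd (prod_decode c)"
    let ?F = "\<lambda>n. (\<lambda>x. x - z i (s n)) ` En (s n)"
    have Fm: "?F n \<in> sets lebesgue" for n
      using shift_in_lebesgue[OF En[of "s n"], of "- z i (s n)"] by simp
    have "P (?F n) UNIV = P (En (s n)) UNIV" for n
      by (rule lattice_periodic_recenter(2)[OF per z En])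
    then have "(SUP n. P (?F n) UNIV) \<le> (SUP n. P (En n) UNIV)"
      by (intro SUP_least) (auto intro: SUP_upper)
    then have "(SUP n. P (?F n) UNIV) < \<infinity>" using bd by (rule le_less_trans)
    then have "\<exists>\<phi>. \<exists>E\<in>sets lebesgue. strict_mono \<phi> \<and> L1loc_tendsto (\<lambda>n. ?F (\<phi> n) \<inter> UNIV) E"
      using Fm by (intro P[unfolded perimeter_compactness_def, rule_format]) auto
    then obtain r1 E where r1: "strict_mono r1" "E \<in> sets lebesgue" "L1loc_tendsto (\<lambda>n. ?F (r1 n)) E"
      by auto
    then have q1: "Q1 i (s \<circ> r1)" unfolding Q1_def by auto
    obtain r2 where r2: "strict_mono r2"
      "filterlim (\<lambda>n. dist (z i (s (r1 (r2 n)))) (z j (s (r1 (r2 n))))) at_top sequentially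
       \<or> (\<exists>B. eventually (\<lambda>n. dist (z i (s (r1 (r2 n)))) (z j (s (r1 (r2 n)))) \<le> B) sequentially)"
      using at_top_or_bounded_subseq[of "\<lambda>n. dist (z i (s (r1 n))) (z j (s (r1 n)))"] by blast
    have "Q2 i j (s \<circ> r1 \<circ> r2)" using r2(2) unfolding Q2_def by simp
    with Q1_sub[OF r2(1) q1] have "Q c (s \<circ> (r1 \<circ> r2))"
      by (simp add: Q_def i_def j_def o_assoc)
    then show "\<exists>r'. strict_mono r' \<and> Q c (s \<circ> r')"
      using strict_mono_o[OF r1(1) r2(1)] by blast
  qed
  \<comment> \<open>Requirement \<open>c\<close> is met only once the first \<open>Suc c\<close>
    terms are dropped, hence the offsets removed below.\<close>
  have Qd: "Q c (diagseq \<circ> (+) (Suc c))" for c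
    by (rule diagseq_holds) (auto simp: Q_def Q1_sub Q2_sub)
  have "\<exists>G\<in>sets lebesgue. L1loc_tendsto (\<lambda>n. (\<lambda>x. x - z i (diagseq n)) ` En (diagseq n)) G" for i
  proof -
    let ?c = "prod_encode (i, i)"
    have "Q1 i (diagseq \<circ> (+) (Suc ?c))" using Qd[of ?c] by (simp add: Q_def)
    then obtain G where G: "G \<in> sets lebesgue"
      "L1loc_tendsto (\<lambda>n. (\<lambda>x. x - z i (diagseq (n + Suc ?c))) ` En (diagseq (n + Suc ?c))) G"
      unfolding Q1_def by (auto simp: add.commute)
    show ?thesis
      by (rule bexI[OF _ G(1)], rule L1loc_tendsto_offset[where k = "Suc ?c"]) (rule G(2))
  qed
  then obtain G where G: "\<And>i. G i \<in> sets lebesgue"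
    "\<And>i. L1loc_tendsto (\<lambda>n. (\<lambda>x. x - z i (diagseq n)) ` En (diagseq n)) (G i)"
    by metis
  show thesis
  proof (rule that[OF subseq_diagseq G])
    fix i j
    let ?c = "prod_encode (i, j)" and ?f = "\<lambda>n. dist (z i (diagseq n)) (z j (diagseq n))"
    have "Q2 i j (diagseq \<circ> (+) (Suc ?c))" using Qd[of ?c] by (simp add: Q_def)
    then have "filterlim (\<lambda>n. ?f (n + Suc ?c)) at_top sequentially
        \<or> (\<exists>B. eventually (\<lambda>n. ?f (n + Suc ?c) \<le> B) sequentially)"
      unfolding Q2_def by (simp add: add.commute)
    then show "filterlim ?f at_top sequentially \<or> (\<exists>B. eventually (\<lambda>n. ?f n \<le> B) sequentially)"
      unfolding filterlim_at_top
        eventually_sequentially_seg[of "\<lambda>n. ?f n \<le> B" "Suc ?c" for B]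
        eventually_sequentially_seg[of "\<lambda>n. B \<le> ?f n" "Suc ?c" for B] .
  qed
qed

context concentration_setting
begin

text \<open>
  Seen from \<open>N\<close> centers drifting away from a fixed set \<open>E\<close>, the limit is \<open>N\<close> copies of the empty set.
\<close>

lemma energy_empty_le_0:
  assumes r1: "0 < r1" and E: "E \<in> sets lebesgue" "emeasure lebesgue E = ennreal M" "H E UNIV < \<infinity>"
  shows "H {} UNIV \<le> 0"
proof (rule ccontr)
  assume "\<not> H {} UNIV \<le> 0"
  then have pos: "0 < H {} UNIV" by simp
  obtain k :: 'd where True by blast
  define u :: "real^'d" where "u = r1 *\<^sub>R axis k 1"
  \<comment> \<open>The centers move along one lattice direction at different speeds, so they drift
    apart linearly in \<open>n\<close>.\<close>
  define z where "z = (\<lambda>i n :: nat. (real i * real n) *\<^sub>R u)"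
  have u: "norm u = r1" using r1 by (simp add: u_def)
  have zL: "z i n \<in> cubic_lattice r1" for i n
    unfolding cubic_lattice_def
  proof (intro CollectI allI)
    fix l show "\<exists>w::int. z i n $ l = r1 * of_int w"
      by (intro exI[of _ "if l = k then int i * int n else 0"]) (simp add: z_def u_def axis_def)
  qed
  have lim: "filterlim (\<lambda>n. c * real n) at_top sequentially" if "0 < c" for c :: real
    using filterlim_tendsto_pos_mult_at_top[OF tendsto_const that filterlim_real_sequentially] .
  have dist: "dist (z i n) (z j n) = (\<bar>real i - real j\<bar> * r1) * real n" for i j n
  proof -
    have "z i n - z j n = ((real i - real j) * real n) *\<^sub>R u"
      by (simp add: z_def algebra_simps)
    then show ?thesis by (simp add: dist_norm u abs_mult)
  qed
  have Ef: "E \<in> lmeasurable" using E by (intro fmeasurableI) auto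
  \<comment> \<open>Indices start at 1: center 0 never moves, and the limit seen from it would be
    \<open>E\<close>. As \<open>N\<close> is arbitrary, positive energy of the empty set would
    contradict this bound.\<close>
  have bound: "(\<Sum>i\<in>{1..N}. H {} UNIV) \<le> H E UNIV + ereal (\<eta>1 (M - (\<Sum>i\<in>{1..N}. measure lebesgue ({} :: (real^'d) set))))"
    if N: "1 \<le> N" for N :: nat
  proof (rule limit_energy_le[where En = "\<lambda>n. E" and z = z and G = "\<lambda>i. {}"])
    fix i assume "i \<in> {1..N}"
    then have "0 < real i * r1" using r1 by simp
    have "norm (z i n) = (real i * r1) * real n" for n by (simp add: z_def u)
    then have "filterlim (\<lambda>n. norm (z i n)) at_top sequentially"
      using lim[OF \<open>0 < real i * r1\<close>] by simp
    then show "L1loc_tendsto (\<lambda>n. (\<lambda>x. x - z i n) ` E) {}"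
      by (rule L1loc_tendsto_escaping[OF Ef])
  next
    fix i j :: nat assume "i \<noteq> j"
    then show "filterlim (\<lambda>n. dist (z i n) (z j n)) at_top sequentially"
      unfolding dist using r1 by (intro lim) simp
  qed (use E zL N in auto)
  have HE: "H E UNIV \<noteq> -\<infinity>" using E by (intro not_MInf) auto
  obtain a where a: "H E UNIV = ereal a" using HE E(3) by (cases "H E UNIV") auto
  have "H {} UNIV \<noteq> \<infinity>" using bound[of 1] by (auto simp: a)
  then obtain b where b: "H {} UNIV = ereal b" using pos by (cases "H {} UNIV") auto
  obtain N where "a + \<eta>1 M < real N * b"
    using pos b reals_Archimedean3[of b] by auto
  also have "\<dots> \<le> real (Suc N) * b" using pos b by (intro mult_right_mono) auto
  also have "\<dots> \<le> a + \<eta>1 M"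
    using bound[of "Suc N"] by (simp add: a b)
  finally show False by simp
qed

section \<open>One component for each class of centers: its mass and its energy\<close>

context
  fixes En :: "nat \<Rightarrow> (real^'d) set" and z :: "nat \<Rightarrow> nat \<Rightarrow> real^'d"
    and G :: "nat \<Rightarrow> (real^'d) set" and e :: ereal and D :: real
  assumes En: "\<And>n. En n \<in> sets lebesgue" "\<And>n. emeasure lebesgue (En n) = ennreal M"
    and z: "\<And>i n. z i n \<in> cubic_lattice r1"
    and alt: "\<And>i j. filterlim (\<lambda>n. dist (z i n) (z j n)) at_top sequentially
      \<or> (\<exists>B. eventually (\<lambda>n. dist (z i n) (z j n) \<le> B) sequentially)"
    and G: "\<And>i. G i \<in> sets lebesgue" "\<And>i. L1loc_tendsto (\<lambda>n. (\<lambda>x. x - z i n) ` En n) (G i)"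
    and e: "(\<lambda>n. H (En n) UNIV) \<longlonglongrightarrow> e"
    and e_finite: "e < \<infinity>"
    and tight: "\<And>\<epsilon>. 0 < \<epsilon> \<Longrightarrow> \<exists>I. \<forall>n. measure lebesgue (En n - (\<Union>i<I. ball (z i n) D)) \<le> \<epsilon>"
    and empty: "H {} UNIV = 0"
begin

definition leader :: "nat \<Rightarrow> bool" where
  "leader i \<longleftrightarrow> (\<forall>j<i. filterlim (\<lambda>n. dist (z i n) (z j n)) at_top sequentially)"

text \<open>Only the first center of each class of centers at bounded distance contributes.\<close>

definition component :: "nat \<Rightarrow> (real^'d) set" where
  "component i = (if leader i then G i else {})"

lemma leader_0: "leader 0" by (simp add: leader_def)

lemma leader_diverge:
  assumes "leader i" "leader j" "i \<noteq> j"
  shows "filterlim (\<lambda>n. dist (z i n) (z j n)) at_top sequentially"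
proof (cases "j < i")
  case True
  then show ?thesis using assms(1) by (simp add: leader_def)
next
  case False
  then have "i < j" using assms(3) by simp
  then have "filterlim (\<lambda>n. dist (z j n) (z i n)) at_top sequentially"
    using assms(2) by (simp add: leader_def)
  then show ?thesis by (simp add: dist_commute)
qed

text \<open>A center that is not a leader stays at bounded distance from an earlier one. Strong
  induction continues from there, and the triangle inequality adds the two bounds.\<close>

lemma near_leader: "\<exists>j\<le>i. leader j \<and> (\<exists>B. eventually (\<lambda>n. dist (z i n) (z j n) \<le> B) sequentially)"
proof (induction i rule: less_induct)
  case (less i)
  show ?case
  proof (cases "leader i")
    case True
    then show ?thesis by (intro exI[of _ i]) (auto intro!: exI[of _ 0])
  next
    case False
    then obtain j where j: "j < i" "\<not> filterlim (\<lambda>n. dist (z i n) (z j n)) at_top sequentially"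
      by (auto simp: leader_def)
    then obtain B where B: "eventually (\<lambda>n. dist (z i n) (z j n) \<le> B) sequentially"
      using alt by blast
    obtain k B' where k: "k \<le> j" "leader k" "eventually (\<lambda>n. dist (z j n) (z k n) \<le> B') sequentially"
      using less[OF j(1)] by blast
    have "eventually (\<lambda>n. dist (z i n) (z k n) \<le> B + B') sequentially"
      using B k(3)
    proof eventually_elim
      case (elim n)
      then show ?case using dist_triangle[of "z i n" "z k n" "z j n"] by linarith
    qed
    then show ?thesis using k j by (intro exI[of _ k]) auto
  qed
qed

lemma leaders_limit:
  assumes "finite A" "A \<noteq> {}" "\<And>i. i \<in> A \<Longrightarrow> leader i"
  shows "(\<Sum>i\<in>A. measure lebesgue (G i)) \<le> M"
    and "i \<in> A \<Longrightarrow> G i \<in> lmeasurable"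
    and "0 < R \<Longrightarrow> (\<lambda>n. measure lebesgue (En n - (\<Union>i\<in>A. ball (z i n) R)))
      \<longlonglongrightarrow> M - (\<Sum>i\<in>A. measure lebesgue (G i \<inter> ball 0 R))"
    and "(\<Sum>i\<in>A. H (G i) UNIV) \<le> e + ereal (\<eta>1 (M - (\<Sum>i\<in>A. measure lebesgue (G i))))"
proof -
  have div: "filterlim (\<lambda>n. dist (z i n) (z j n)) at_top sequentially" if "i \<in> A" "j \<in> A" "i \<noteq> j" for i j
    using that assms(3) by (intro leader_diverge)
  note prem = En assms(1,2) z div G e
  show "(\<Sum>i\<in>A. measure lebesgue (G i)) \<le> M"
    by (rule limit_measure_le[OF prem])
  show "i \<in> A \<Longrightarrow> G i \<in> lmeasurable"
    by (rule limit_lmeasurable[OF prem])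
  show "0 < R \<Longrightarrow> (\<lambda>n. measure lebesgue (En n - (\<Union>i\<in>A. ball (z i n) R)))
      \<longlonglongrightarrow> M - (\<Sum>i\<in>A. measure lebesgue (G i \<inter> ball 0 R))"
    by (rule measure_outside_tendsto[OF prem])
  show "(\<Sum>i\<in>A. H (G i) UNIV) \<le> e + ereal (\<eta>1 (M - (\<Sum>i\<in>A. measure lebesgue (G i))))"
    by (rule limit_energy_le[OF prem])
qed

lemma component_lmeasurable: "component i \<in> lmeasurable"
  using leaders_limit(2)[of "{i}" i] by (auto simp: component_def)

text \<open>Indices that are not leaders contribute \<open>g {} = 0\<close>. This will be used for
  the measure and, since the empty set has energy 0, for \<open>H\<close>.\<close>

lemma sum_component:
  assumes "g {} = (0 :: 'b :: comm_monoid_add)"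
  shows "(\<Sum>i<I. g (component i)) = (\<Sum>i\<in>{i. i < I \<and> leader i}. g (G i))"
proof -
  have "(\<Sum>i<I. g (component i)) = (\<Sum>i<I. if leader i then g (G i) else 0)"
    by (intro sum.cong) (auto simp: component_def assms)
  also have "\<dots> = (\<Sum>i\<in>{i \<in> {..<I}. leader i}. g (G i))"
    by (rule sum.inter_filter[symmetric]) simp
  finally show ?thesis by simp
qed

lemma leaders_ne: "0 < I \<Longrightarrow> {i. i < I \<and> leader i} \<noteq> {}"
  using leader_0 by blast

lemma sum_measure_component_le: "(\<Sum>i<I. measure lebesgue (component i)) \<le> M"
proof (cases "I = 0")
  case False
  then show ?thesis
    unfolding sum_component[of "measure lebesgue", OF measure_empty]
    using leaders_ne by (intro leaders_limit) auto
qed (use M_pos in simp)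

text \<open>By tightness \<open>I\<close> balls miss at most \<open>\<epsilon>\<close>. Each of them
  lies eventually in a larger ball about the leader of its class, so the leaders alone miss at most
  \<open>\<epsilon>\<close> in the limit.\<close>

lemma sum_measure_component_ge:
  assumes "0 < \<epsilon>"
  shows "\<exists>I. M - \<epsilon> \<le> (\<Sum>i<I. measure lebesgue (component i))"
proof -
  obtain I where I: "\<And>n. measure lebesgue (En n - (\<Union>i<I. ball (z i n) D)) \<le> \<epsilon>"
    using tight[OF assms] by blast
  \<comment> \<open>With \<open>Suc I\<close> the leader 0 belongs to \<open>A\<close>, which is
    therefore nonempty even if \<open>I\<close> is 0.\<close>
  define A where "A = {i. i < Suc I \<and> leader i}"
  have A: "finite A" "A \<noteq> {}" "\<And>i. i \<in> A \<Longrightarrow> leader i"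
    using leaders_ne[of "Suc I"] by (auto simp: A_def)
  obtain p B where p: "\<And>i. p i \<le> i" "\<And>i. leader (p i)"
    "\<And>i. eventually (\<lambda>n. dist (z i n) (z (p i) n) \<le> B i) sequentially"
    using near_leader by metis
  \<comment> \<open>One radius for all \<open>i < I\<close>: the sum dominates each distance bound
    \<open>B i\<close>, and the summand 1 makes \<open>R\<close> positive.\<close>
  define R where "R = \<bar>D\<bar> + (\<Sum>i<I. \<bar>B i\<bar>) + 1"
  have R: "0 < R" unfolding R_def by (intro add_nonneg_pos add_nonneg_nonneg sum_nonneg) auto
  have "eventually (\<lambda>n. \<forall>i\<in>{..<I}. dist (z i n) (z (p i) n) \<le> B i) sequentially"
    using p(3) by (intro eventually_ball_finite) auto
  then have ev: "eventually (\<lambda>n. measure lebesgue (En n - (\<Union>i\<in>A. ball (z i n) R)) \<le> \<epsilon>) sequentially"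
  proof eventually_elim
    case (elim n)
    have "ball (z i n) D \<subseteq> (\<Union>i\<in>A. ball (z i n) R)" if i: "i < I" for i
    proof
      fix x assume "x \<in> ball (z i n) D"
      moreover have "dist (z i n) (z (p i) n) \<le> B i" using elim i by simp
      moreover have "\<bar>B i\<bar> \<le> (\<Sum>i<I. \<bar>B i\<bar>)" using i by (intro member_le_sum) auto
      ultimately have "dist (z (p i) n) x < R"
        using dist_triangle[of "z (p i) n" x "z i n"] by (simp add: R_def dist_commute)
      moreover have "p i \<in> A" using p(1,2)[of i] i by (auto simp: A_def)
      ultimately show "x \<in> (\<Union>i\<in>A. ball (z i n) R)" by auto
    qed
    then have sub: "En n - (\<Union>i\<in>A. ball (z i n) R) \<subseteq> En n - (\<Union>i<I. ball (z i n) D)" by blast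
    have Enf: "En n \<in> lmeasurable" using En by (intro fmeasurableI) auto
    have "measure lebesgue (En n - (\<Union>i\<in>A. ball (z i n) R)) \<le> measure lebesgue (En n - (\<Union>i<I. ball (z i n) D))"
    proof (rule measure_mono_fmeasurable[OF sub])
      show "En n - (\<Union>i<I. ball (z i n) D) \<in> lmeasurable"
        by (rule fmeasurable_Diff[OF Enf]) auto
      show "En n - (\<Union>i\<in>A. ball (z i n) R) \<in> sets lebesgue"
        using En(1) by (intro sets.Diff) auto
    qed
    then show ?case using I[of n] by linarith
  qed
  have "M - (\<Sum>i\<in>A. measure lebesgue (G i \<inter> ball 0 R)) \<le> \<epsilon>"
    by (rule tendsto_upperbound[OF leaders_limit(3)[OF A R] ev sequentially_bot])
  moreover have "(\<Sum>i\<in>A. measure lebesgue (G i \<inter> ball 0 R)) \<le> (\<Sum>i\<in>A. measure lebesgue (G i))"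
    using leaders_limit(2)[OF A] G(1)
    by (intro sum_mono measure_mono_fmeasurable) auto
  ultimately have "M - \<epsilon> \<le> (\<Sum>i\<in>A. measure lebesgue (G i))" by linarith
  also have "\<dots> = (\<Sum>i<Suc I. measure lebesgue (component i))"
    unfolding A_def by (rule sum_component[of "measure lebesgue", OF measure_empty, symmetric])
  finally show ?thesis by blast
qed

lemma component_measure_sums: "(\<lambda>i. measure lebesgue (component i)) sums M"
  unfolding sums_def
proof (rule LIMSEQ_I)
  fix r :: real assume "0 < r"
  then obtain I where I: "M - r / 2 \<le> (\<Sum>i<I. measure lebesgue (component i))"
    using sum_measure_component_ge[of "r / 2"] by auto
  show "\<exists>I. \<forall>n\<ge>I. norm ((\<Sum>i<n. measure lebesgue (component i)) - M) < r"
  proof (intro exI allI impI)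
    fix n assume "I \<le> n"
    then have "(\<Sum>i<I. measure lebesgue (component i)) \<le> (\<Sum>i<n. measure lebesgue (component i))"
      by (intro sum_mono2) auto
    then show "norm ((\<Sum>i<n. measure lebesgue (component i)) - M) < r"
      using I sum_measure_component_le[of n] \<open>0 < r\<close> by (simp add: abs_less_iff)
  qed
qed

lemma component_admissible: "gen_admissible M component"
proof -
  have "(\<Sum>i. emeasure lebesgue (component i)) = (\<Sum>i. ennreal (measure lebesgue (component i)))"
    using component_lmeasurable by (simp add: emeasure_eq_measure2)
  also have "\<dots> = ennreal M"
    by (rule suminf_ennreal_eq[OF _ component_measure_sums]) simp
  finally show ?thesis
    using component_lmeasurable by (auto simp: gen_admissible_def)
qed

text \<open>The finite-family bound on the components of positive energy makes the series of
  positive parts converge, so the whole series has a limit, possibly \<open>-\<infinity>\<close>. On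
  initial segments the missing mass tends to 0, and the same bound tends to
  \<open>e\<close>.\<close>

lemma component_energy_sums: "\<exists>s\<le>e. (\<lambda>i. H (component i) UNIV) sums s"
proof -
  have nMI: "H (G i) UNIV \<noteq> -\<infinity>" for i using G(1) by (intro not_MInf) auto
  have lead: "H (G i) UNIV \<le> e + ereal (\<eta>1 (M - measure lebesgue (G i)))" if "leader i" for i
    using leaders_limit(4)[of "{i}"] that by simp
  \<comment> \<open>The limit at the leader 0 has energy above \<open>-\<infinity>\<close>, and that
    energy is at most \<open>e\<close> plus a real number.\<close>
  have "e \<noteq> -\<infinity>" using lead[OF leader_0] nMI[of 0] by auto
  then obtain e' where e': "e = ereal e'" using e_finite by (cases e) auto
  have "\<exists>b. H (component i) UNIV = ereal b" for i
  proof (cases "leader i")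
    case True
    then show ?thesis using lead[OF True] nMI[of i]
      by (cases "H (G i) UNIV") (auto simp: component_def e')
  qed (use empty in \<open>auto simp: component_def intro: exI[of _ 0]\<close>)
  then obtain b where b: "\<And>i. H (component i) UNIV = ereal (b i)" by metis
  have b_leader: "ereal (b i) = H (G i) UNIV" if "leader i" for i
    using b[of i] that by (simp add: component_def)
  have b_not: "b i = 0" if "\<not> leader i" for i
    using b[of i] that empty by (simp add: component_def)
  have le: "sum b A \<le> e' + \<eta>1 (M - (\<Sum>i\<in>A. measure lebesgue (G i)))"
    if A: "finite A" "A \<noteq> {}" "\<And>i. i \<in> A \<Longrightarrow> leader i" for A
  proof -
    have "ereal (sum b A) = (\<Sum>i\<in>A. ereal (b i))" by simp
    also have "\<dots> = (\<Sum>i\<in>A. H (G i) UNIV)" using A(3) by (intro sum.cong b_leader) auto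
    also have "\<dots> \<le> e + ereal (\<eta>1 (M - (\<Sum>i\<in>A. measure lebesgue (G i))))"
      by (rule leaders_limit(4)[OF A])
    finally show ?thesis by (simp add: e')
  qed
  \<comment> \<open>The missing mass of any family of leaders lies in \<open>{0..M}\<close>, so
    compactness gives one bound \<open>C\<close> for all error terms.\<close>
  have "compact (\<eta>1 ` {0..M})"
    by (intro compact_continuous_image continuous_on_subset[OF eta(1)]) auto
  then obtain C where C: "\<And>t. t \<in> {0..M} \<Longrightarrow> \<eta>1 t \<le> C"
    by (meson bdd_above.E bounded_imp_bdd_above compact_imp_bounded image_eqI)
  have pos: "summable (\<lambda>i. max (b i) 0)"
  proof (rule summableI_nonneg_bounded)
    fix I
    define A where "A = {i. i < I \<and> 0 < b i}"
    have A: "finite A" "\<And>i. i \<in> A \<Longrightarrow> leader i" using b_not by (force simp: A_def)+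
    have "(\<Sum>i<I. max (b i) 0) = (\<Sum>i<I. if 0 < b i then b i else 0)"
      by (intro sum.cong) auto
    also have "\<dots> = (\<Sum>i\<in>{i \<in> {..<I}. 0 < b i}. b i)"
      by (rule sum.inter_filter[symmetric]) simp
    also have "\<dots> = sum b A" by (simp add: A_def)
    also have "\<dots> \<le> max 0 (e' + C)"
    proof (cases "A = {}")
      case False
      have "sum b A \<le> e' + \<eta>1 (M - (\<Sum>i\<in>A. measure lebesgue (G i)))"
        using A False by (intro le)
      also have "\<dots> \<le> e' + C"
        using leaders_limit(1)[OF A(1) False A(2)] by (intro add_left_mono C) (auto intro: sum_nonneg)
      finally show ?thesis by simp
    qed simp
    finally show "(\<Sum>i<I. max (b i) 0) \<le> max 0 (e' + C)" .
  qed simp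
  define p where "p = (\<Sum>i. max (b i) 0)"
  \<comment> \<open>The negative parts are summed in the extended reals: at this point nothing
    excludes \<open>q = \<infinity>\<close>, and \<open>ereal p + - q\<close> is still defined since
    \<open>p\<close> is real.\<close>
  define q where "q = (SUP I. ereal (\<Sum>i<I. max (- b i) 0))"
  have "(\<lambda>I. ereal (\<Sum>i<I. max (b i) 0)) \<longlonglongrightarrow> ereal p"
    using summable_LIMSEQ[OF pos] by (simp add: p_def)
  moreover have "(\<lambda>I. - ereal (\<Sum>i<I. max (- b i) 0)) \<longlonglongrightarrow> - q"
    unfolding q_def by (intro tendsto_uminus_ereal LIMSEQ_SUP) (auto simp: incseq_def intro!: sum_mono2)
  ultimately have "(\<lambda>I. ereal (\<Sum>i<I. max (b i) 0) + - ereal (\<Sum>i<I. max (- b i) 0)) \<longlonglongrightarrow> ereal p + - q"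
    by (rule tendsto_add_ereal_general[rotated]) simp
  moreover have "ereal (\<Sum>i<I. max (b i) 0) + - ereal (\<Sum>i<I. max (- b i) 0) = (\<Sum>i<I. H (component i) UNIV)" for I
  proof -
    have "(\<Sum>i<I. b i) = (\<Sum>i<I. max (b i) 0 - max (- b i) 0)"
      by (intro sum.cong) auto
    then show ?thesis by (simp add: b sum_subtractf)
  qed
  ultimately have lim: "(\<lambda>I. \<Sum>i<I. H (component i) UNIV) \<longlonglongrightarrow> ereal p + - q" by simp
  have "ereal p + - q \<le> e"
  proof (rule LIMSEQ_le[OF lim])
    have "(\<lambda>I. \<eta>1 (M - (\<Sum>i<I. measure lebesgue (component i)))) \<longlonglongrightarrow> \<eta>1 (M - M)"
      using sum_measure_component_le component_measure_sums
      by (intro continuous_on_tendsto_compose[OF eta(1)] tendsto_diff tendsto_const) (auto simp: sums_def)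
    then have "(\<lambda>I. e' + \<eta>1 (M - (\<Sum>i<I. measure lebesgue (component i)))) \<longlonglongrightarrow> e' + 0"
      by (intro tendsto_add tendsto_const) (simp add: eta(2))
    then show "(\<lambda>I. ereal (e' + \<eta>1 (M - (\<Sum>i<I. measure lebesgue (component i))))) \<longlonglongrightarrow> e"
      by (simp add: e')
    show "\<exists>N. \<forall>I\<ge>N. (\<Sum>i<I. H (component i) UNIV) \<le> ereal (e' + \<eta>1 (M - (\<Sum>i<I. measure lebesgue (component i))))"
    proof (intro exI[of _ 1] allI impI)
      fix I :: nat assume I: "1 \<le> I"
      define A where "A = {i. i < I \<and> leader i}"
      have A: "finite A" "A \<noteq> {}" "\<And>i. i \<in> A \<Longrightarrow> leader i" using leaders_ne[of I] I by (auto simp: A_def)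
      have "(\<Sum>i<I. H (component i) UNIV) = (\<Sum>i\<in>A. H (G i) UNIV)"
        unfolding A_def by (rule sum_component[of "\<lambda>E. H E UNIV", OF empty])
      also have "\<dots> \<le> e + ereal (\<eta>1 (M - (\<Sum>i\<in>A. measure lebesgue (G i))))"
        by (rule leaders_limit(4)[OF A])
      also have "(\<Sum>i\<in>A. measure lebesgue (G i)) = (\<Sum>i<I. measure lebesgue (component i))"
        unfolding A_def by (rule sum_component[of "measure lebesgue", OF measure_empty, symmetric])
      finally show "(\<Sum>i<I. H (component i) UNIV) \<le> ereal (e' + \<eta>1 (M - (\<Sum>i<I. measure lebesgue (component i))))"
        by (simp add: e')
    qed
  qed
  then show ?thesis using lim unfolding sums_def by blast
qed

lemma exists_admissible_energy_le:
  "\<exists>Es. gen_admissible M Es \<and> (\<exists>s\<le>e. (\<lambda>i. H (Es i) UNIV) sums s)"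
  using component_admissible component_energy_sums by blast

end

end

section \<open>Existence of generalized minimizers\<close>

text \<open>A cube of the right side length. It makes the set of competitors nonempty, so that a
  minimizing sequence exists.\<close>

lemma exists_lebesgue_measure:
  assumes "0 < m"
  shows "\<exists>E :: (real^'d::finite) set. E \<in> sets lebesgue \<and> emeasure lebesgue E = ennreal m"
proof -
  let ?E = "cbox 0 (\<chi> k. root CARD('d) m) :: (real^'d) set"
  have pos: "0 < root CARD('d) m" using assms by simp
  have "measure lborel ?E = (\<Prod>k\<in>(UNIV::'d set). root CARD('d) m)"
    using pos by (subst content_cbox_cart) (auto simp: interval_ne_empty_cart less_imp_le)
  also have "\<dots> = m" using assms by simp
  finally have "measure lebesgue ?E = m" by simp
  then have "emeasure lebesgue ?E = ennreal m"
    using emeasure_eq_measure2[OF lmeasurable_cbox, of 0 "(\<chi> k. root CARD('d) m) :: real^'d"] by simp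
  then show ?thesis by (intro exI[of _ ?E]) auto
qed

text \<open>This competitor settles the degenerate cases, where the infimum is infinite or the empty
  set has negative energy.\<close>

lemma gen_admissible_single:
  assumes "E \<in> sets lebesgue" "emeasure lebesgue E = ennreal m"
  shows "gen_admissible m (\<lambda>i. if i = 0 then E else {})"
proof -
  have "(\<Sum>i. emeasure lebesgue (if i = 0 then E else {})) = (\<Sum>i\<in>{0::nat}. emeasure lebesgue (if i = 0 then E else {}))"
    by (rule suminf_finite) auto
  then show ?thesis using assms by (auto simp: gen_admissible_def)
qed

lemma gen_min_energy_le:
  assumes "gen_admissible m Es" "(\<lambda>i. energy P V (Es i)) sums s"
  shows "gen_min_energy P V m \<le> s"
  unfolding gen_min_energy_def using assms by (intro Inf_lower) blast

lemma sum_single_energy: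
  "(\<Sum>i<Suc n. energy P V (if i = 0 then E else {})) = energy P V E + (\<Sum>i<n. energy P V {})"
  by (subst sum.lessThan_Suc_shift) simp

theorem theorem1p2:
  fixes P V :: "'d::finite rel_functional"
    and m r0 r1 :: real
    and f1 :: "real \<Rightarrow> real"
  assumes "CARD('d) \<ge> 2"
    and "m > 0"
    and "\<And>E U. E \<in> sets lebesgue \<Longrightarrow> U \<in> sets lebesgue \<Longrightarrow> 0 \<le> P E U"
    and "\<And>E U. E \<in> sets lebesgue \<Longrightarrow> U \<in> sets lebesgue \<Longrightarrow> V E U \<noteq> -\<infinity>"
    and "relative_isoperimetric r0 f1 P"
    and "0 < r1" and "r1 \<le> 2 * r0 / sqrt (real CARD('d))"
    and "lattice_periodic r1 P" and "lattice_periodic r1 V"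
    and "perimeter_set_operations P"
    and "bounded_perimeter P V"
    and "perimeter_compactness P"
    and "lower_semicontinuity P" and "lower_semicontinuity V"
    and "beppo_levi P" and "beppo_levi V"
    and "weak_superadditivity V"
    and "min_energy P V m = gen_min_energy P V m"
  shows "\<exists>Es. gen_admissible m Es \<and> (\<lambda>i. energy P V (Es i)) sums gen_min_energy P V m"
proof -
  note m = assms(2) and Ppos = assms(3) and Vne = assms(4) and P = assms(10)
  define e where "e = min_energy P V m"
  have e: "e = gen_min_energy P V m" using assms(18) by (simp add: e_def)
  let ?S = "{energy P V E | E. E \<in> sets lebesgue \<and> emeasure lebesgue E = ennreal m}"
  obtain E0 :: "(real^'d) set" where E0: "E0 \<in> sets lebesgue" "emeasure lebesgue E0 = ennreal m"
    using exists_lebesgue_measure[OF m] by blast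
  obtain u where u: "\<And>n. u n \<in> ?S" "u \<longlonglongrightarrow> e"
    using Inf_as_limit[of ?S] E0 unfolding e_def min_energy_def by blast
  show ?thesis
  proof (cases "e = \<infinity>")
    case True
    \<comment> \<open>If the common infimum is \<open>\<infinity>\<close>, any set of mass
      \<open>m\<close> padded with empty sets attains it, as all its nonempty partial sums are
      infinite.\<close>
    let ?Es = "\<lambda>i::nat. if i = 0 then E0 else {}"
    have "e \<le> energy P V E0"
      unfolding e_def min_energy_def using E0 by (intro Inf_lower) blast
    then have "energy P V E0 = \<infinity>" using True by simp
    then have inf: "(\<Sum>i<Suc n. energy P V (?Es i)) = \<infinity>" for n
      unfolding sum_single_energy by simp
    have "(\<lambda>i. energy P V (?Es i)) sums \<infinity>"
      unfolding sums_def by (rule LIMSEQ_imp_Suc) (simp only: inf tendsto_const)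
    then show ?thesis
      using gen_admissible_single[OF E0] True e by metis
  next
    case False
    then have e_lt: "e < \<infinity>" by simp
    define H where "H = (\<lambda>E U. P E U + V E U)"
    have H: "energy P V E = H E UNIV" for E by (simp add: energy_def H_def)
    have Pne: "P E U \<noteq> -\<infinity>" if "E \<in> sets lebesgue" "U \<in> sets lebesgue" for E U
      using Ppos[OF that] by auto
    obtain \<eta>1 \<eta>2 where \<eta>:
      "continuous_on {0..} \<eta>1" "\<eta>1 0 = 0" "(\<eta>2 \<longlongrightarrow> 0) at_top"
      "\<And>E R (A :: nat set) c. E \<in> sets lebesgue \<Longrightarrow> 0 < R \<Longrightarrow> finite A \<Longrightarrow> A \<noteq> {} \<Longrightarrow>
       emeasure lebesgue E \<le> ennreal m \<Longrightarrow>
       (\<And>i j. i \<in> A \<Longrightarrow> j \<in> A \<Longrightarrow> i \<noteq> j \<Longrightarrow> 7 * R \<le> dist (c i) (c j)) \<Longrightarrow>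
       (\<Sum>i\<in>A. H E (ball (c i) R))
         \<le> H E UNIV + (ereal (\<eta>1 (measure lebesgue (E - (\<Union>i\<in>A. ball (c i) R)))) + ereal (\<eta>2 R))"
      using weak_superadditivity_add[OF P assms(17) m] unfolding H_def by blast
    interpret concentration_setting H r1 m \<eta>1 \<eta>2
    proof
      show "H E U \<noteq> -\<infinity>" if "E \<in> sets lebesgue" "U \<in> sets lebesgue" for E U
        using Pne[OF that] Vne[OF that] by (simp add: H_def)
      show "lattice_periodic r1 H"
        using assms(8,9) by (simp add: lattice_periodic_def H_def)
      show "lower_semicontinuity H"
        unfolding H_def by (rule lower_semicontinuity_add[OF assms(13,14) Pne Vne])
      show "beppo_levi H"
        unfolding H_def by (rule beppo_levi_add[OF assms(15,16) Pne Vne])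
    qed (fact m \<eta>)+
    \<comment> \<open>Dropping the first \<open>n0\<close> terms leaves energies below a real
      \<open>C\<close>, as the bounded perimeter hypothesis and the sign of \<open>H {} UNIV\<close>
      require.\<close>
    obtain C where C: "e < ereal C" using e_lt ereal_dense2 by (metis)
    obtain n0 where n0: "\<And>n. n0 \<le> n \<Longrightarrow> u n < ereal C"
      using order_tendstoD(2)[OF u(2) C] unfolding eventually_sequentially by blast
    have "\<forall>n. \<exists>E. E \<in> sets lebesgue \<and> emeasure lebesgue E = ennreal m \<and> u (n + n0) = H E UNIV"
      using u(1) unfolding H by blast
    then obtain En where En: "\<And>n. En n \<in> sets lebesgue" "\<And>n. emeasure lebesgue (En n) = ennreal m"
        "\<And>n. u (n + n0) = H (En n) UNIV"
      by metis
    have En_le: "H (En n) UNIV \<le> ereal C" for n using n0[of "n + n0"] En(3)[of n] by simp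
    have lim: "(\<lambda>n. H (En n) UNIV) \<longlonglongrightarrow> e"
      using LIMSEQ_ignore_initial_segment[OF u(2), of n0] by (simp add: En(3))
    have "H {} UNIV \<le> 0"
      using En_le[of 0] by (intro energy_empty_le_0[OF assms(6) En(1,2)[of 0]]) auto
    then consider "H {} UNIV < 0" | "H {} UNIV = 0" by fastforce
    then show ?thesis
    proof cases
      case 1
      \<comment> \<open>Adding empty components drives the generalized infimum to \<open>-\<infinity>\<close>, so it is attained.\<close>
      let ?Es = "\<lambda>i::nat. if i = 0 then En 0 else {}"
      have "H {} UNIV \<noteq> -\<infinity>" "H (En 0) UNIV \<noteq> -\<infinity>" 
        using not_MInf[of "{}" UNIV] not_MInf[OF En(1)[of 0], of UNIV] by auto
      then obtain a b where a: "H (En 0) UNIV = ereal a" and b: "H {} UNIV = ereal b" "b < 0"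
        using 1 En_le[of 0] by (cases "H {} UNIV"; cases "H (En 0) UNIV") auto
      have part: "(\<Sum>i<Suc n. energy P V (?Es i)) = ereal (a + b * real n)" for n
        unfolding sum_single_energy by (simp add: H a b mult.commute)
      have "filterlim (\<lambda>n. a + b * real n) at_bot sequentially"
        unfolding filterlim_uminus_at_bot
        using filterlim_tendsto_add_at_top[OF tendsto_const[of "- a"]
            filterlim_tendsto_pos_mult_at_top[OF tendsto_const[of "- b"] _ filterlim_real_sequentially]] b(2)
        by simp
      then have "(\<lambda>n. \<Sum>i<Suc n. energy P V (?Es i)) \<longlonglongrightarrow> -\<infinity>"
        
        unfolding part tendsto_MInfty filterlim_at_bot_dense by simp
      then have sums: "(\<lambda>i. energy P V (?Es i)) sums -\<infinity>"
        unfolding sums_def by (rule LIMSEQ_imp_Suc)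
      have adm: "gen_admissible m ?Es" by (rule gen_admissible_single[OF En(1,2)])
      have "gen_min_energy P V m = -\<infinity>" using gen_min_energy_le[OF adm sums] by simp
      then show ?thesis using adm sums by metis
    next
      case 2
      have "(SUP n. energy P V (En n)) \<le> ereal C"
        unfolding H using En_le by (rule SUP_least)
      then have "(SUP n. energy P V (En n)) < \<infinity>" by (rule le_less_trans) simp
      moreover have "(SUP n. emeasure lebesgue (En n)) < \<infinity>" by (simp add: En(2))
      ultimately have Pfin: "(SUP n. P (En n) UNIV) < \<infinity>"
        using assms(11)[unfolded bounded_perimeter_def, rule_format, of En] En(1) by blast
      then obtain C' where C': "(SUP n. P (En n) UNIV) < ereal C'" using ereal_dense2 by metis
      \<comment> \<open>The maximum supplies the nonnegative constant asked for in
        \<open>uniform_tightness\<close>.\<close>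
      have Ple: "P (En n) UNIV \<le> ereal (max 0 C')" for n
      proof -
        have "P (En n) UNIV \<le> (SUP n. P (En n) UNIV)" by (rule SUP_upper) simp
        also have "\<dots> \<le> ereal (max 0 C')" using C' by (auto intro: less_imp_le order_trans)
        finally show ?thesis .
      qed
      define D where "D = r1 * sqrt (real CARD('d)) / 2 + norm (\<chi> k::'d. r1 / 2)"
      have tight: "\<exists>N. \<forall>n. \<exists>S\<subseteq>cubic_lattice r1. finite S \<and> card S \<le> N \<and>
          measure lebesgue (En n - (\<Union>v\<in>S. ball v D)) \<le> \<epsilon>" if \<epsilon>: "0 < \<epsilon>" for \<epsilon>
      proof -
        have "\<exists>N. \<forall>E\<in>sets lebesgue. emeasure lebesgue E \<le> ennreal m \<longrightarrow> P E UNIV \<le> ereal (max 0 C') \<longrightarrow>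
          (\<exists>S\<subseteq>cubic_lattice r1. finite S \<and> card S \<le> N \<and> measure lebesgue (E - (\<Union>v\<in>S. ball v D)) \<le> \<epsilon>)"
          unfolding D_def
          by (rule uniform_tightness[OF assms(5-7) P _ \<epsilon> less_imp_le[OF m] max.cobounded1]) (rule Ppos)
        then obtain N where N: "\<forall>E\<in>sets lebesgue. emeasure lebesgue E \<le> ennreal m \<longrightarrow> P E UNIV \<le> ereal (max 0 C') \<longrightarrow>
          (\<exists>S\<subseteq>cubic_lattice r1. finite S \<and> card S \<le> N \<and> measure lebesgue (E - (\<Union>v\<in>S. ball v D)) \<le> \<epsilon>)" ..
        show ?thesis
        proof (intro exI[of _ N] allI)
          fix n show "\<exists>S\<subseteq>cubic_lattice r1. finite S \<and> card S \<le> N \<and>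
              measure lebesgue (En n - (\<Union>v\<in>S. ball v D)) \<le> \<epsilon>"
            by (rule N[rule_format, OF En(1) _ Ple]) (simp add: En(2))
        qed
      qed
      have Ef: "En n \<in> lmeasurable" for n using En(1,2) by (intro fmeasurableI) auto
      obtain z :: "nat \<Rightarrow> nat \<Rightarrow> real^'d" where z: "\<And>i n. z i n \<in> cubic_lattice r1"
        "\<And>\<epsilon>. 0 < \<epsilon> \<Longrightarrow> \<exists>I. \<forall>n. measure lebesgue (En n - (\<Union>i<I. ball (z i n) D)) \<le> \<epsilon>"
        by (rule centers_of_tight_sequence[OF Ef tight zero_in_cubic_lattice]) (assumption, rule that)
      obtain s G where s: "strict_mono s" and G: "\<And>i. G i \<in> sets lebesgue"
        "\<And>i. L1loc_tendsto (\<lambda>n. (\<lambda>x. x - z i (s n)) ` En (s n)) (G i)"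
        and alt: "\<And>i j. filterlim (\<lambda>n. dist (z i (s n)) (z j (s n))) at_top sequentially
          \<or> (\<exists>B. eventually (\<lambda>n. dist (z i (s n)) (z j (s n)) \<le> B) sequentially)"
        by (rule extract_limits[OF assms(12,8) En(1) Pfin z(1)]) (rule that)
      have lim': "(\<lambda>n. H (En (s n)) UNIV) \<longlonglongrightarrow> e"
        using LIMSEQ_subseq_LIMSEQ[OF lim s] by (simp add: o_def)
      have tight': "\<exists>I. \<forall>n. measure lebesgue (En (s n) - (\<Union>i<I. ball (z i (s n)) D)) \<le> \<epsilon>" if "0 < \<epsilon>" for \<epsilon>
        using z(2)[OF that] by blast
      have "\<exists>Es. gen_admissible m Es \<and> (\<exists>t\<le>e. (\<lambda>i. H (Es i) UNIV) sums t)"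
        by (rule exists_admissible_energy_le[where En = "\<lambda>n. En (s n)" and z = "\<lambda>i n. z i (s n)",
            OF En(1,2) z(1) alt G lim' e_lt tight' 2])
      then obtain Es t where Es: "gen_admissible m Es" and t: "t \<le> e" "(\<lambda>i. H (Es i) UNIV) sums t"
        by blast
      have sums: "(\<lambda>i. energy P V (Es i)) sums t" using t(2) by (simp add: H)
      \<comment> \<open>Admissibility gives one inequality. The other is \<open>t \<le> e\<close>
        together with the assumed equality of the two infima.\<close>
      have "t = gen_min_energy P V m"
        using gen_min_energy_le[OF Es sums] t(1) e by simp
      then show ?thesis using Es sums by blast
    qed
  qed
qed

end
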